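(* Let $f:\mathbb{R}^n\to\mathbb{R}$ be convex and of the form $f(x)=\max_{i=1,\dots,m}f_i(x)$ with each $f_i:\mathbb{R}^n\to\mathbb{R}$ of class $\mathcal{C}^{2+}$, and suppose that for every $x\in\mathbb{R}^n$ the set of active gradients $\{\nabla f_i(x): i\in A(x)\}$ is affinely independent. Fix $\bar x\in\mathbb{R}^n$. Then there exist a constant $\mu$ (depending on $\bar x$) and a subgradient $g\in\operatorname{ri}\partial f(\bar x)$ such that for all sufficiently small $\varepsilon>0$ one can obtain (as outputs of the first-order approximation subroutine with input $(\bar x,\varepsilon)$): (i) an approximate subgradient $g^\varepsilon$ such that $$\|g^\varepsilon-g\|\le\varepsilon\mu,\qquad \|g^\varepsilon_{\mathcal U}-g_{\mathcal U}\|\le\varepsilon\mu\qquad\text{and}\qquad \|g^\varepsilon_{\mathcal V}-g_{\mathcal V}\|\le\varepsilon\mu;$$ (ii) the approximate $\mathcal U$-gradient $\nabla_\varepsilon L_{\mathcal U}(0;g^\varepsilon_{\mathcal V})$ such that $$\|\nabla_\varepsilon L_{\mathcal U}(0;g^\varepsilon_{\mathcal V})-\nabla L_{\mathcal U}(0;g_{\mathcal V})\|\le\varepsilon\mu.$$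
   Context: A function is of class $\mathcal C^{2+}$ if all its partial derivatives of degree $0$ to $2$ exist and are locally Lipschitz continuous. The active index set is $A(x)=\{i: f_i(x)=f(x)\}$. A set $\{\nabla f_i(x): i\in A(x)\}$ is affinely independent if the only scalars with $\sum_{i\in A(x)}\lambda_i\nabla f_i(x)=0$ and $\sum_{i\in A(x)}\lambda_i=0$ are $\lambda_i=0$ for all $i\in A(x)$. $\partial f$ is the convex subdifferential and $\operatorname{ri}$ denotes relative interior. $\|\cdot\|$ is the Euclidean norm and $e_1,\dots,e_n$ are the canonical vectors. Exact objects at $\bar x$. For $g\in\operatorname{ri}\partial f(\bar x)$, $\mathcal V(\bar x)=\operatorname{span}\{\partial f(\bar x)-g\}$ and $\mathcal U(\bar x)=\mathcal V(\bar x)^\perp$ (independent of the choice of $g$). Let $I$ be the first element of $A(\bar x)$. $V$ denotes the basis matrix of $\mathcal V(\bar x)$ with columns $\nabla f_i(\bar x)-\nabla f_I(\bar x)$, $i\in A(\bar x)\setminus\{I\}$, and $U$ denotes an orthonormal basis matrix of $\mathcal U(\bar x)$. For $g\in\mathbb{R}^n$, $g_{\mathcal U}=U^\top g$ and $g_{\mathcal V}=(V^\top V)^{-1}V^\top g$. The $\mathcal U$-Lagrangian is $$L_{\mathcal U}(u;g_{\mathcal V})=\min_{v\in\mathbb{R}^{\dim\mathcal V}}\{f(\bar x+Uu+Vv)-g^\top Vv\},$$ and the $\mathcal U$-gradient $\nabla L_{\mathcal U}(0;g_{\mathcal V})$ is its gradient with respect to $u$ at $u=0$. First-order approximation subroutine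 with input $(\bar x,\varepsilon)$. For $Y=[\bar x,\ \bar x+\varepsilon e_1,\dots,\bar x+\varepsilon e_n]$, the simplex gradient of $f_i$ over $Y$, $\nabla_\varepsilon f_i(Y)$, is the vector whose $l$-th component is $(f_i(\bar x+\varepsilon e_l)-f_i(\bar x))/\varepsilon$. The outputs are $$g^\varepsilon=\frac1{|A(\bar x)|}\sum_{i\in A(\bar x)}\nabla_\varepsilon f_i(Y);$$ the matrix $V_\varepsilon$ with columns $\nabla_\varepsilon f_i(Y)-\nabla_\varepsilon f_I(Y)$, $i\in A(\bar x)\setminus\{I\}$; a matrix $U_\varepsilon$ whose columns form an orthonormal basis of the null space of $V_\varepsilon^\top$ (the choice of this basis is free, and "one can obtain" allows it to be chosen suitably for each $\varepsilon$); and the approximate $\mathcal U$-gradient $\nabla_\varepsilon L_{\mathcal U}(0;g^\varepsilon_{\mathcal V})=U_\varepsilon^\top g^\varepsilon$. The components of $g^\varepsilon$ are taken in the approximate bases: $g^\varepsilon_{\mathcal U}=U_\varepsilon^\top g^\varepsilon$ and $g^\varepsilon_{\mathcal V}=(V_\varepsilon^\top V_\varepsilon)^{-1}V_\varepsilon^\top g^\varepsilon$. If $|A(\bar x)|=1$ then $\mathcal V$ is trivial and $\mathcal V$-components are absent; trivial $\mathcal U$ is treated similarly. *)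

theory Defs
  imports "HOL-Analysis.Analysis"
begin

section \<open>Smooth pieces and the max-function\<close>

definition partial_deriv :: "'n::finite \<Rightarrow> (real^'n \<Rightarrow> real) \<Rightarrow> real^'n \<Rightarrow> real" where
  "partial_deriv l h x = deriv (\<lambda>t. h (x + t *\<^sub>R axis l 1)) 0"

definition has_partial_derivs :: "(real^'n::finite \<Rightarrow> real) \<Rightarrow> bool" where
  "has_partial_derivs h \<longleftrightarrow>
     (\<forall>l x. (\<lambda>t::real. h (x + t *\<^sub>R axis l 1)) field_differentiable (at 0))"

definition grad :: "(real^'n::finite \<Rightarrow> real) \<Rightarrow> real^'n \<Rightarrow> real^'n" where
  "grad h x = (\<chi> l. partial_deriv l h x)"

text \<open>The library's \<^const>\<open>local_lipschitz\<close> is for families of functions; here it is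
  applied to a one-element family.\<close>

definition locally_lipschitz :: "('a::metric_space \<Rightarrow> 'b::metric_space) \<Rightarrow> bool" where
  "locally_lipschitz h \<longleftrightarrow> local_lipschitz {0::real} UNIV (\<lambda>_. h)"

definition C2plus :: "(real^'n::finite \<Rightarrow> real) \<Rightarrow> bool" where
  "C2plus h \<longleftrightarrow>
     locally_lipschitz h \<and>
     has_partial_derivs h \<and>
     (\<forall>l. locally_lipschitz (partial_deriv l h)) \<and>
     (\<forall>l. has_partial_derivs (partial_deriv l h)) \<and>
     (\<forall>l l'. locally_lipschitz (partial_deriv l' (partial_deriv l h)))"

text \<open>Throughout, \<open>F 1, \<dots>, F m\<close> are the pieces of the max-function \<open>f\<close>.\<close>

definition active :: "(real^'n::finite \<Rightarrow> real) \<Rightarrow> (nat \<Rightarrow> real^'n \<Rightarrow> real) \<Rightarrow> nat \<Rightarrow> real^'n \<Rightarrow> nat set" where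
  "active f F m x = {i \<in> {1..m}. F i x = f x}"

abbreviation first_active :: "(real^'n::finite \<Rightarrow> real) \<Rightarrow> (nat \<Rightarrow> real^'n \<Rightarrow> real) \<Rightarrow> nat \<Rightarrow> real^'n \<Rightarrow> nat" where
  "first_active f F m x \<equiv> Min (active f F m x)"

text \<open>Affine independence of an indexed family; in contrast to \<^const>\<open>affine_dependent\<close>,
  which speaks about the underlying set, repeated vectors count as dependent.\<close>

definition affinely_independent_family :: "'i set \<Rightarrow> ('i \<Rightarrow> 'a::real_vector) \<Rightarrow> bool" where
  "affinely_independent_family A w \<longleftrightarrow>
     (\<forall>c::'i \<Rightarrow> real. (\<Sum>i\<in>A. c i *\<^sub>R w i) = 0 \<and> (\<Sum>i\<in>A. c i) = 0 \<longrightarrow> (\<forall>i\<in>A. c i = 0))"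

definition subdifferential :: "('a::real_inner \<Rightarrow> real) \<Rightarrow> 'a \<Rightarrow> 'a set" where
  "subdifferential f x = {s. \<forall>y. f y \<ge> f x + s \<bullet> (y - x)}"

section \<open>Matrices with a variable number of columns\<close>

text \<open>The number of columns of the matrices below depends on the point, so such a matrix is
  represented by its columns: a family \<open>W :: nat \<Rightarrow> real^'n\<close> together with a finite set
  \<open>J\<close> of column indices. Coordinate vectors are functions \<open>nat \<Rightarrow> real\<close> of which only the
  values on \<open>J\<close> matter, and their Euclidean norm is \<open>L2_set c J\<close>. If \<open>J\<close> is empty, the
  coordinate space is trivial and all norms are \<open>0\<close>.\<close>

definition mult_vec :: "nat set \<Rightarrow> (nat \<Rightarrow> real^'n::finite) \<Rightarrow> (nat \<Rightarrow> real) \<Rightarrow> real^'n" where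
  "mult_vec J W c = (\<Sum>j\<in>J. c j *\<^sub>R W j)"

definition transpose_mult_vec :: "(nat \<Rightarrow> real^'n::finite) \<Rightarrow> real^'n \<Rightarrow> nat \<Rightarrow> real" where
  "transpose_mult_vec W x = (\<lambda>j. W j \<bullet> x)"

text \<open>The inverse of a square matrix indexed by \<open>J\<close>, in the style of \<^const>\<open>matrix_inv\<close>.\<close>

definition inverse_on :: "nat set \<Rightarrow> (nat \<Rightarrow> nat \<Rightarrow> real) \<Rightarrow> nat \<Rightarrow> nat \<Rightarrow> real" where
  "inverse_on J M = (SOME N. \<forall>i\<in>J. \<forall>j\<in>J.
     (\<Sum>k\<in>J. M i k * N k j) = (if i = j then 1 else 0) \<and>
     (\<Sum>k\<in>J. N i k * M k j) = (if i = j then 1 else 0))"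

text \<open>\<open>(W\<^sup>T W)\<^sup>-\<^sup>1 W\<^sup>T x\<close>\<close>

definition V_component :: "nat set \<Rightarrow> (nat \<Rightarrow> real^'n::finite) \<Rightarrow> real^'n \<Rightarrow> nat \<Rightarrow> real" where
  "V_component J W x =
     (\<lambda>j. \<Sum>l\<in>J. inverse_on J (\<lambda>i k. W i \<bullet> W k) j l * transpose_mult_vec W x l)"

definition null_space_transpose :: "nat set \<Rightarrow> (nat \<Rightarrow> real^'n::finite) \<Rightarrow> (real^'n) set" where
  "null_space_transpose J W = {x. \<forall>j\<in>J. transpose_mult_vec W x j = 0}"

text \<open>The columns \<open>U 0, \<dots>, U (k - 1)\<close> form an orthonormal basis of the subspace \<open>S\<close>;
  in particular \<open>k = dim S\<close>.\<close>

definition orthonormal_basis_matrix :: "nat \<Rightarrow> (nat \<Rightarrow> real^'n::finite) \<Rightarrow> (real^'n) set \<Rightarrow> bool" where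
  "orthonormal_basis_matrix k U S \<longleftrightarrow>
     (\<forall>a<k. \<forall>b<k. U a \<bullet> U b = (if a = b then 1 else 0)) \<and> span (U ` {..<k}) = S"

text \<open>\<open>d\<close> is the (Frechet) gradient of \<open>\<phi>\<close>, a function of the coordinates in \<open>J\<close>, at \<open>u0\<close>.\<close>

definition has_gradient_at :: "nat set \<Rightarrow> ((nat \<Rightarrow> real) \<Rightarrow> real) \<Rightarrow> (nat \<Rightarrow> real) \<Rightarrow> (nat \<Rightarrow> real) \<Rightarrow> bool" where
  "has_gradient_at J \<phi> d u0 \<longleftrightarrow>
     (\<forall>e>0. \<exists>\<delta>>0. \<forall>u. L2_set (\<lambda>j. u j - u0 j) J < \<delta> \<longrightarrow>
        \<bar>\<phi> u - \<phi> u0 - (\<Sum>j\<in>J. d j * (u j - u0 j))\<bar> \<le> e * L2_set (\<lambda>j. u j - u0 j) J)"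

section \<open>Exact VU-objects\<close>

definition V_space :: "(real^'n::finite \<Rightarrow> real) \<Rightarrow> real^'n \<Rightarrow> real^'n \<Rightarrow> (real^'n) set" where
  "V_space f x g = span ((\<lambda>s. s - g) ` subdifferential f x)"

definition U_space :: "(real^'n::finite \<Rightarrow> real) \<Rightarrow> real^'n \<Rightarrow> real^'n \<Rightarrow> (real^'n) set" where
  "U_space f x g = orthogonal_comp (V_space f x g)"

definition V_indices :: "(real^'n::finite \<Rightarrow> real) \<Rightarrow> (nat \<Rightarrow> real^'n \<Rightarrow> real) \<Rightarrow> nat \<Rightarrow> real^'n \<Rightarrow> nat set" where
  "V_indices f F m x = active f F m x - {first_active f F m x}"

definition V_matrix :: "(real^'n::finite \<Rightarrow> real) \<Rightarrow> (nat \<Rightarrow> real^'n \<Rightarrow> real) \<Rightarrow> nat \<Rightarrow> real^'n \<Rightarrow> nat \<Rightarrow> real^'n" where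
  "V_matrix f F m x = (\<lambda>i. grad (F i) x - grad (F (first_active f F m x)) x)"

text \<open>The \<open>\<U>\<close>-Lagrangian for bases \<open>U\<close> (columns \<open>0, \<dots>, k - 1\<close>) and \<open>V\<close> (columns in \<open>J\<close>).
  It depends on \<open>g\<close> only through its \<open>\<V>\<close>-component. \<^const>\<open>Least\<close> expresses an attained
  minimum.\<close>

definition U_Lagrangian ::
  "(real^'n::finite \<Rightarrow> real) \<Rightarrow> real^'n \<Rightarrow> nat \<Rightarrow> (nat \<Rightarrow> real^'n) \<Rightarrow> nat set \<Rightarrow> (nat \<Rightarrow> real^'n) \<Rightarrow>
     real^'n \<Rightarrow> (nat \<Rightarrow> real) \<Rightarrow> real" where
  "U_Lagrangian f x k U J V g u =
     (LEAST y. \<exists>v. y = f (x + mult_vec {..<k} U u + mult_vec J V v) - g \<bullet> mult_vec J V v)"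

section \<open>First-order approximation\<close>

definition simplex_gradient :: "real \<Rightarrow> (real^'n::finite \<Rightarrow> real) \<Rightarrow> real^'n \<Rightarrow> real^'n" where
  "simplex_gradient \<epsilon> h x = (\<chi> l. (h (x + \<epsilon> *\<^sub>R axis l 1) - h x) / \<epsilon>)"

text \<open>\<open>g\<^sub>\<epsilon>\<close>, \<open>V\<^sub>\<epsilon>\<close> (columns indexed by \<^const>\<open>V_indices\<close>), \<open>U\<^sub>\<epsilon>\<close> (with \<open>k\<close> columns) and the
  approximate \<open>\<U>\<close>-gradient \<open>d\<^sub>\<epsilon>\<close> are possible outputs of the subroutine with input \<open>(x, \<epsilon>)\<close>.
  This is a relation because the orthonormal basis \<open>U\<^sub>\<epsilon>\<close> may be chosen freely.\<close>

definition first_order_output ::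
  "(real^'n::finite \<Rightarrow> real) \<Rightarrow> (nat \<Rightarrow> real^'n \<Rightarrow> real) \<Rightarrow> nat \<Rightarrow> real^'n \<Rightarrow> real \<Rightarrow>
     real^'n \<Rightarrow> (nat \<Rightarrow> real^'n) \<Rightarrow> nat \<Rightarrow> (nat \<Rightarrow> real^'n) \<Rightarrow> (nat \<Rightarrow> real) \<Rightarrow> bool" where
  "first_order_output f F m x \<epsilon> g\<^sub>\<epsilon> V\<^sub>\<epsilon> k U\<^sub>\<epsilon> d\<^sub>\<epsilon> \<longleftrightarrow>
     g\<^sub>\<epsilon> = (1 / real (card (active f F m x))) *\<^sub>R
            (\<Sum>i\<in>active f F m x. simplex_gradient \<epsilon> (F i) x) \<and>
     V\<^sub>\<epsilon> = (\<lambda>i. simplex_gradient \<epsilon> (F i) x - simplex_gradient \<epsilon> (F (first_active f F m x)) x) \<and>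
     orthonormal_basis_matrix k U\<^sub>\<epsilon> (null_space_transpose (V_indices f F m x) V\<^sub>\<epsilon>) \<and>
     d\<^sub>\<epsilon> = transpose_mult_vec U\<^sub>\<epsilon> g\<^sub>\<epsilon>"

end

theory Submission
  imports Defs
begin

text \<open>
  Take for \<open>g\<close> the average of the active gradients. As \<open>\<partial>f(xb)\<close> is their convex hull, \<open>g\<close> lies in
  its relative interior and \<open>\<V>\<close> is spanned by the columns of \<open>V\<close>. Moving within \<open>\<partial>f(xb)\<close> around \<open>g\<close>
  gives \<open>f (xb + u + y) \<ge> f xb + g \<bullet> u + g \<bullet> y + \<eta> \<parallel>y\<parallel>\<close> for \<open>u \<in> \<U>\<close> and \<open>y \<in> \<V>\<close>, so the
  \<open>\<U>\<close>-Lagrangian is an attained minimum bounded below by \<open>f xb + g \<bullet> u\<close>. It is bounded above by its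
  value \<open>f (xb + u)\<close> at \<open>v = 0\<close>, which is \<open>f xb + g \<bullet> u + O(\<parallel>u\<parallel>\<^sup>2)\<close> since all active gradients have the
  same inner product with \<open>u\<close>. Hence the \<open>\<U>\<close>-gradient is \<open>U\<^sup>T g\<close>; no implicit function is needed.

  The simplex gradients are \<open>O(\<epsilon>)\<close> accurate because the partial derivatives are locally Lipschitz.
  The errors of the \<open>\<V>\<close>-components follow from the normal equations and the stability of linear
  independence. For the \<open>\<U>\<close>-components, projecting \<open>U\<close> onto the null space of the perturbed
  transpose moves it by \<open>O(\<epsilon>)\<close>, and Gram--Schmidt turns the result into an orthonormal
  basis at distance \<open>O(\<epsilon>)\<close> from \<open>U\<close>.
\<close>

section \<open>First-order expansion of the pieces\<close>

text \<open>\<open>partial_deriv\<close> records a derivative at parameter 0 only. Re-basing at the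
  point with parameter \<open>t\<close> and shifting the parameter gives the derivative along the
  whole axis-parallel line, as the mean value inequality requires.\<close>

lemma has_field_derivative_partial_deriv:
  fixes h :: "real^'n::finite \<Rightarrow> real"
  assumes "has_partial_derivs h"
  shows "((\<lambda>t. h (x + t *\<^sub>R axis l 1)) has_field_derivative
           partial_deriv l h (x + t *\<^sub>R axis l 1)) (at t)"
proof -
  have "((\<lambda>s. h ((x + t *\<^sub>R axis l 1) + s *\<^sub>R axis l 1)) has_field_derivative
           partial_deriv l h (x + t *\<^sub>R axis l 1)) (at (t - t))"
    using assms unfolding has_partial_derivs_def partial_deriv_def
    by (simp add: field_differentiable_derivI)
  then have "((\<lambda>s. h ((x + t *\<^sub>R axis l 1) + (s - t) *\<^sub>R axis l 1)) has_field_derivative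
           partial_deriv l h (x + t *\<^sub>R axis l 1)) (at t)"
    using DERIV_chain2[where g = "\<lambda>s. s - t"] DERIV_diff[OF DERIV_ident DERIV_const] by fastforce
  then show ?thesis by (simp add: algebra_simps)
qed

lemma locally_lipschitz_eventually_le:
  assumes "locally_lipschitz h"
  shows "\<exists>L\<ge>0. \<forall>\<^sub>F y in nhds x. dist (h y) (h x) \<le> L * dist y x"
proof -
  obtain u L where u: "u > 0" and L: "L-lipschitz_on (cball x u \<inter> UNIV) h"
    using local_lipschitzE[OF assms[unfolded locally_lipschitz_def], of 0 x]
    by (metis centre_in_cball IntI UNIV_I insertI1 less_eq_real_def)
  have "\<forall>\<^sub>F y in nhds x. y \<in> ball x u"
    using u by (intro eventually_nhds_in_open) auto
  then have "\<forall>\<^sub>F y in nhds x. dist (h y) (h x) \<le> L * dist y x"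
  proof eventually_elim
    case (elim y)
    then show ?case using lipschitz_onD[OF L, of y x] u by auto
  qed
  then show ?thesis using lipschitz_on_nonneg[OF L] by blast
qed

text \<open>Total differentiability is built from partial derivatives by changing one coordinate at
  a time. On each axis-parallel segment the partial derivative stays within a Lipschitz error of its
  value at \<open>x\<close>, so each coordinate contributes an error of second order.\<close>

lemma first_order_expansion:
  fixes h :: "real^'n::finite \<Rightarrow> real"
  assumes pd: "has_partial_derivs h" and lip: "\<And>l. locally_lipschitz (partial_deriv l h)"
  shows "\<exists>C\<ge>0. \<forall>\<^sub>F y in nhds x. \<bar>h y - h x - grad h x \<bullet> (y - x)\<bar> \<le> C * (norm (y - x))\<^sup>2"
proof -
  have "\<exists>L\<ge>0. \<forall>\<^sub>F y in nhds x. \<bar>partial_deriv l h y - partial_deriv l h x\<bar> \<le> L * norm (y - x)" for l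
    using locally_lipschitz_eventually_le[OF lip[of l], of x] by (simp add: dist_norm)
  then obtain K where K0: "\<And>l. K l \<ge> 0"
    and K: "\<And>l. \<forall>\<^sub>F y in nhds x. \<bar>partial_deriv l h y - partial_deriv l h x\<bar> \<le> K l * norm (y - x)"
    by metis
  define L where "L = sum K UNIV"
  have KL: "K l \<le> L" for l unfolding L_def using K0 by (simp add: member_le_sum)
  have L0: "L \<ge> 0" unfolding L_def using K0 by (simp add: sum_nonneg)
  have "\<forall>\<^sub>F y in nhds x. \<forall>l. \<bar>partial_deriv l h y - partial_deriv l h x\<bar> \<le> K l * norm (y - x)"
    using K by (rule eventually_all_finite)
  then have "\<forall>\<^sub>F y in nhds x. \<forall>l. \<bar>partial_deriv l h y - partial_deriv l h x\<bar> \<le> L * norm (y - x)"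
    by eventually_elim (meson KL order_trans mult_right_mono norm_ge_zero)
  then obtain r where r: "r > 0"
    and R: "\<And>y l. dist y x < r \<Longrightarrow> \<bar>partial_deriv l h y - partial_deriv l h x\<bar> \<le> L * norm (y - x)"
    unfolding eventually_nhds_metric by blast
  \<comment> \<open>Induction on a set \<open>S\<close> of coordinates that contains the support of
    \<open>w\<close>; each new coordinate adds one \<open>L\<close> to the constant.\<close>
  have main: "\<bar>h (x + w) - h x - (\<Sum>l\<in>S. partial_deriv l h x * w $ l)\<bar> \<le> real (card S) * L * (norm w)\<^sup>2"
    if "finite S" "norm w < r" "\<forall>l. l \<notin> S \<longrightarrow> w $ l = 0" for S and w :: "real^'n"
    using that
  proof (induction S arbitrary: w rule: finite_induct)
    case empty
    then have "w = 0" by (simp add: vec_eq_iff)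
    then show ?case by simp
  next
    case (insert l S)
    define w' where "w' = w - (w $ l) *\<^sub>R axis l 1"
    have w'c: "w' $ j = (if j = l then 0 else w $ j)" for j
      by (simp add: w'_def axis_def)
    have nw': "norm w' \<le> norm w" by (rule norm_le_componentwise_cart) (simp add: w'c)
    have "\<bar>h (x + w') - h x - (\<Sum>j\<in>S. partial_deriv j h x * w' $ j)\<bar> \<le> real (card S) * L * (norm w')\<^sup>2"
      using insert.prems nw' by (intro insert.IH) (auto simp: w'c)
    also have "(\<Sum>j\<in>S. partial_deriv j h x * w' $ j) = (\<Sum>j\<in>S. partial_deriv j h x * w $ j)"
      using insert.hyps by (intro sum.cong) (auto simp: w'c)
    also have "real (card S) * L * (norm w')\<^sup>2 \<le> real (card S) * L * (norm w)\<^sup>2"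
      using nw' L0 by (intro mult_left_mono power_mono) auto
    finally have 1: "\<bar>h (x + w') - h x - (\<Sum>j\<in>S. partial_deriv j h x * w $ j)\<bar>
        \<le> real (card S) * L * (norm w)\<^sup>2" .
    \<comment> \<open>With the linear term subtracted, the derivative of \<open>\<phi>\<close> is
      the deviation of the partial derivative from its value at \<open>x\<close>.\<close>
    define \<phi> where "\<phi> t = h (x + w' + t *\<^sub>R axis l 1) - partial_deriv l h x * t" for t
    have "norm (\<phi> (w $ l) - \<phi> 0) \<le> (L * norm w) * norm (w $ l - 0)"
    proof (rule field_differentiable_bound)
      show "convex (closed_segment 0 (w $ l))" by simp
      fix t assume t: "t \<in> closed_segment 0 (w $ l)"
      show "(\<phi> has_field_derivative
          (partial_deriv l h (x + w' + t *\<^sub>R axis l 1) - partial_deriv l h x)) (at t within closed_segment 0 (w $ l))"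
        unfolding \<phi>_def
        by (rule derivative_eq_intros has_field_derivative_at_within[OF has_field_derivative_partial_deriv[OF pd]] refl)+ simp
      \<comment> \<open>Each component of a point on the segment is dominated by that of
        \<open>w\<close>, so the segment stays in the ball where the Lipschitz bound holds.\<close>
      have "\<bar>t\<bar> \<le> \<bar>w $ l\<bar>" using t by (auto simp: closed_segment_eq_real_ivl split: if_splits)
      then have n: "norm (w' + t *\<^sub>R axis l 1) \<le> norm w"
        by (intro norm_le_componentwise_cart) (auto simp: w'c axis_def)
      have "\<bar>partial_deriv l h (x + w' + t *\<^sub>R axis l 1) - partial_deriv l h x\<bar>
          \<le> L * norm ((x + w' + t *\<^sub>R axis l 1) - x)"
        using n insert.prems by (intro R) (simp add: dist_norm add.assoc)
      also have "\<dots> \<le> L * norm w" using n L0 by (intro mult_left_mono) (simp_all add: add.assoc)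
      finally show "norm (partial_deriv l h (x + w' + t *\<^sub>R axis l 1) - partial_deriv l h x) \<le> L * norm w"
        by simp
    qed auto
    also have "\<dots> \<le> L * norm w * norm w"
      using L0 component_le_norm_cart[of w l] by (intro mult_left_mono) auto
    finally have "\<bar>h (x + w) - h (x + w') - partial_deriv l h x * w $ l\<bar> \<le> L * (norm w)\<^sup>2"
      by (simp add: \<phi>_def w'_def power2_eq_square algebra_simps)
    with 1 show ?case using insert.hyps by (simp add: algebra_simps)
  qed
  have "\<forall>\<^sub>F y in nhds x. \<bar>h y - h x - grad h x \<bullet> (y - x)\<bar> \<le> (real CARD('n) * L) * (norm (y - x))\<^sup>2"
    unfolding eventually_nhds_metric
  proof (intro exI conjI allI impI)
    fix y assume "dist y x < r"
    then show "\<bar>h y - h x - grad h x \<bullet> (y - x)\<bar> \<le> (real CARD('n) * L) * (norm (y - x))\<^sup>2"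
      using main[of UNIV "y - x"] by (simp add: dist_norm grad_def inner_vec_def)
  qed (rule r)
  with L0 show ?thesis by (intro exI[of _ "real CARD('n) * L"]) auto
qed

text \<open>Along an axis, dividing the quadratic error of the expansion by \<epsilon> leaves
  C\<epsilon> per component. The factor \<open>CARD('n)\<close> comes from bounding the norm by the
  sum of the components.\<close>

lemma simplex_gradient_error:
  fixes h :: "real^'n::finite \<Rightarrow> real"
  assumes C: "\<forall>\<^sub>F y in nhds x. \<bar>h y - h x - grad h x \<bullet> (y - x)\<bar> \<le> C * (norm (y - x))\<^sup>2"
  shows "\<forall>\<^sub>F \<epsilon> in at_right 0. norm (simplex_gradient \<epsilon> h x - grad h x) \<le> real CARD('n) * C * \<epsilon>"
proof -
  have "\<forall>\<^sub>F \<epsilon> in at_right 0. \<bar>(simplex_gradient \<epsilon> h x - grad h x) $ l\<bar> \<le> C * \<epsilon>" for l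
  proof -
    have "((\<lambda>\<epsilon>. x + \<epsilon> *\<^sub>R axis l 1) \<longlongrightarrow> x + 0 *\<^sub>R axis l 1) (at_right (0::real))"
      by (intro tendsto_intros)
    then have "filterlim (\<lambda>\<epsilon>. x + \<epsilon> *\<^sub>R axis l 1) (nhds x) (at_right (0::real))" by simp
    from filterlim_iff[THEN iffD1, OF this, rule_format, OF C] eventually_at_right_less[of "0::real"]
    show ?thesis
    proof eventually_elim
      case (elim \<epsilon>)
      have "(simplex_gradient \<epsilon> h x - grad h x) $ l
          = (h (x + \<epsilon> *\<^sub>R axis l 1) - h x - \<epsilon> * grad h x $ l) / \<epsilon>"
        using elim(2) by (simp add: simplex_gradient_def field_simps)
      moreover have "\<bar>h (x + \<epsilon> *\<^sub>R axis l 1) - h x - \<epsilon> * grad h x $ l\<bar> \<le> C * \<epsilon>\<^sup>2"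
        using elim(1) by (simp add: inner_axis)
      ultimately show ?case using elim(2)
        by (simp add: abs_divide divide_le_eq power2_eq_square mult.assoc)
    qed
  qed
  then have "\<forall>\<^sub>F \<epsilon> in at_right 0. \<forall>l. \<bar>(simplex_gradient \<epsilon> h x - grad h x) $ l\<bar> \<le> C * \<epsilon>"
    by (rule eventually_all_finite)
  then show ?thesis
  proof eventually_elim
    case (elim \<epsilon>)
    have "norm (simplex_gradient \<epsilon> h x - grad h x) \<le> (\<Sum>l\<in>UNIV. \<bar>(simplex_gradient \<epsilon> h x - grad h x) $ l\<bar>)"
      by (rule norm_le_l1_cart)
    also have "\<dots> \<le> (\<Sum>l\<in>(UNIV::'n set). C * \<epsilon>)" using elim by (intro sum_mono) auto
    finally show ?case by simp
  qed
qed

section \<open>Families of columns and their perturbation\<close>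

lemma mult_vec_in_span: "mult_vec J W c \<in> span (W ` J)"
  unfolding mult_vec_def by (intro span_sum span_scale span_base) auto

lemma span_image_eq_range_mult_vec:
  assumes "finite J" shows "span (W ` J) = range (mult_vec J W)"
proof
  show "span (W ` J) \<subseteq> range (mult_vec J W)"
  proof
    fix y assume "y \<in> span (W ` J)"
    then show "y \<in> range (mult_vec J W)"
    proof (induction rule: span_induct_alt)
      case base
      have "0 = mult_vec J W (\<lambda>_. 0)" by (simp add: mult_vec_def)
      then show ?case by blast
    next
      case (step a x y)
      then obtain j c where j: "j \<in> J" "x = W j" "y = mult_vec J W c" by auto
      have "a *\<^sub>R x = mult_vec J W (\<lambda>i. if i = j then a else 0)"
        using j assms by (simp add: mult_vec_def if_distrib[of "\<lambda>t. t *\<^sub>R _"] cong: if_cong)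
      then have "a *\<^sub>R x + y = mult_vec J W (\<lambda>i. (if i = j then a else 0) + c i)"
        unfolding j mult_vec_def by (simp add: scaleR_add_left sum.distrib)
      then show ?case by blast
    qed
  qed
qed (use mult_vec_in_span in blast)

lemma null_space_transpose_eq:
  "null_space_transpose J W = {x. \<forall>y\<in>span (W ` J). orthogonal y x}"
proof -
  have "orthogonal y x" if "\<forall>j\<in>J. W j \<bullet> x = 0" "y \<in> span (W ` J)" for x y
    using that(2)
    by (induction rule: span_induct_alt) (use that in \<open>auto simp: orthogonal_def inner_add_left\<close>)
  then show ?thesis
    unfolding null_space_transpose_def transpose_mult_vec_def
    by (auto simp: orthogonal_def span_base)
qed

lemma subspace_null_space_transpose: "subspace (null_space_transpose J W)"
  unfolding null_space_transpose_def transpose_mult_vec_def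
  by (auto simp: subspace_def inner_add_right)

text \<open>Quantitative linear independence: \<open>B\<close> bounds the norm of the inverse of \<open>c \<mapsto> W c\<close>.\<close>

definition inverse_bound :: "nat set \<Rightarrow> (nat \<Rightarrow> real^'n::finite) \<Rightarrow> real \<Rightarrow> bool" where
  "inverse_bound J W B \<longleftrightarrow> B \<ge> 0 \<and> (\<forall>c. (\<Sum>j\<in>J. \<bar>c j\<bar>) \<le> B * norm (mult_vec J W c))"

lemma inverse_bound_kernel:
  assumes "finite J" "inverse_bound J W B" "mult_vec J W c = 0"
  shows "\<forall>j\<in>J. c j = 0"
proof -
  have "(\<Sum>j\<in>J. \<bar>c j\<bar>) \<le> 0" using assms(2,3) unfolding inverse_bound_def by (metis norm_zero mult_zero_right)
  then have "(\<Sum>j\<in>J. \<bar>c j\<bar>) = 0" by (intro antisym) (auto intro: sum_nonneg)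
  then show ?thesis using assms(1) by (simp add: sum_nonneg_eq_0_iff)
qed

text \<open>A trivial kernel of the coefficient map excludes repeated columns as well: test it on
  the difference of two unit coefficient vectors. Injectivity then turns independence of the family
  into independence of the set.\<close>

lemma inverse_bound_independent:
  assumes "finite J" "inverse_bound J W B"
  shows "inj_on W J" "independent (W ` J)"
proof -
  note z = inverse_bound_kernel[OF assms, rule_format]
  show inj: "inj_on W J"
  proof (rule inj_onI, rule ccontr)
    fix i j assume ij: "i \<in> J" "j \<in> J" "W i = W j" "i \<noteq> j"
    have "mult_vec J W (\<lambda>l. (if l = i then 1 else 0) - (if l = j then 1 else 0)) = 0"
      using ij assms(1)
      by (simp add: mult_vec_def scaleR_diff_left sum_subtractf if_distrib[of "\<lambda>t. t *\<^sub>R _"] cong: if_cong)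
    from z[OF this ij(1)] ij show False by simp
  qed
  show "independent (W ` J)"
  proof (rule independent_if_scalars_zero)
    fix f x assume "(\<Sum>x\<in>W ` J. f x *\<^sub>R x) = 0" "x \<in> W ` J"
    then show "f x = 0" using z[of "f \<circ> W"] inj by (auto simp: mult_vec_def sum.reindex)
  qed (use assms in auto)
qed

text \<open>The null space is the orthogonal complement of the column span. As its dimension depends
  on \<open>J\<close> alone, exact and perturbed columns have null spaces of equal
  dimension.\<close>

lemma dim_null_space_transpose:
  fixes W :: "nat \<Rightarrow> real^'n::finite"
  assumes "finite J" "inverse_bound J W B"
  shows "dim (null_space_transpose J W) + card J = CARD('n)"
proof -
  have "dim {y \<in> UNIV. \<forall>x\<in>span (W ` J). orthogonal x y} + dim (span (W ` J)) = dim (UNIV :: (real^'n) set)"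
    by (rule dim_subspace_orthogonal_to_vectors) auto
  moreover have "dim (span (W ` J)) = card J"
    using inverse_bound_independent[OF assms] by (simp add: dim_eq_card_independent card_image)
  ultimately show ?thesis by (simp add: null_space_transpose_eq)
qed

text \<open>The dual vector of column \<open>j\<close> is the component of \<open>W j\<close>
  orthogonal to the other columns, rescaled; independence keeps it nonzero.\<close>

lemma dual_family_exists:
  fixes W :: "nat \<Rightarrow> real^'n::finite"
  assumes "finite J" "\<And>c. mult_vec J W c = 0 \<Longrightarrow> \<forall>j\<in>J. c j = 0"
  shows "\<exists>X. \<forall>j\<in>J. X j \<in> span (W ` J) \<and> (\<forall>i\<in>J. W i \<bullet> X j = (if i = j then 1 else 0))"
proof -
  have "\<exists>x. x \<in> span (W ` J) \<and> (\<forall>i\<in>J. W i \<bullet> x = (if i = j then 1 else 0))" if j: "j \<in> J" for j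
  proof -
    obtain y z where y: "y \<in> span (W ` (J - {j}))" and z: "\<And>w. w \<in> span (W ` (J - {j})) \<Longrightarrow> orthogonal z w"
      and W: "W j = y + z"
      using orthogonal_subspace_decomp_exists[of "W ` (J - {j})" "W j"] by blast
    have zi: "W i \<bullet> z = 0" if "i \<in> J" "i \<noteq> j" for i
      using z[of "W i"] that by (auto simp: orthogonal_def inner_commute span_base)
    have zj: "W j \<bullet> z = z \<bullet> z"
      using z[OF y] by (simp add: W inner_add_left orthogonal_def inner_commute[of y z])
    have "z \<noteq> 0"
    proof
      assume "z = 0"
      then obtain c where c: "W j = mult_vec (J - {j}) W c"
        using y W assms(1) by (auto simp: span_image_eq_range_mult_vec)
      \<comment> \<open>The coefficient -1 at \<open>j\<close> turns the dependence of
        \<open>W j\<close> on the other columns into a nontrivial kernel vector.\<close>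
      have "mult_vec J W (c(j := -1)) = mult_vec (J - {j}) W c - W j"
        unfolding mult_vec_def using assms(1) j by (subst sum.remove[of J j]) auto
      with assms(2)[of "c(j := -1)"] c j show False by auto
    qed
    moreover have "z \<in> span (W ` J)"
    proof -
      have "y \<in> span (W ` J)" using y span_mono[of "W ` (J - {j})" "W ` J"] by auto
      moreover have "W j \<in> span (W ` J)" using j by (simp add: span_base)
      ultimately show ?thesis using W span_diff[of "W j" "W ` J" y] by simp
    qed
    ultimately have "z /\<^sub>R (z \<bullet> z) \<in> span (W ` J) \<and> (\<forall>i\<in>J. W i \<bullet> (z /\<^sub>R (z \<bullet> z)) = (if i = j then 1 else 0))"
      using zi zj by (auto simp: span_scale)
    then show ?thesis by blast
  qed
  then show ?thesis by metis
qed

text \<open>Coefficient \<open>j\<close> of a combination is its inner product with dual vector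
  \<open>j\<close>, so Cauchy--Schwarz gives the sum of the dual norms as a bound.\<close>

lemma inverse_bound_exists:
  fixes W :: "nat \<Rightarrow> real^'n::finite"
  assumes fin: "finite J" and ind: "\<And>c. mult_vec J W c = 0 \<Longrightarrow> \<forall>j\<in>J. c j = 0"
  shows "\<exists>B. inverse_bound J W B"
proof -
  obtain X where X: "\<And>i j. i \<in> J \<Longrightarrow> j \<in> J \<Longrightarrow> W i \<bullet> X j = (if i = j then 1 else 0)"
    using dual_family_exists[OF assms] by metis
  have c: "c j = mult_vec J W c \<bullet> X j" if "j \<in> J" for c j
    using that fin by (simp add: mult_vec_def inner_sum_left X if_distrib[of "(*) _"] cong: if_cong)
  have "(\<Sum>j\<in>J. \<bar>c j\<bar>) \<le> (\<Sum>j\<in>J. norm (X j)) * norm (mult_vec J W c)" for c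
  proof -
    have "(\<Sum>j\<in>J. \<bar>c j\<bar>) \<le> (\<Sum>j\<in>J. norm (X j) * norm (mult_vec J W c))"
      by (rule sum_mono) (metis c Cauchy_Schwarz_ineq2 mult.commute)
    then show ?thesis by (simp add: sum_distrib_right)
  qed
  then have "inverse_bound J W (\<Sum>j\<in>J. norm (X j))"
    unfolding inverse_bound_def by (auto intro: sum_nonneg)
  then show ?thesis by blast
qed

section \<open>The Gram matrix and the normal equations\<close>

text \<open>\<open>inverse_on\<close> is a choice, so an actual two-sided inverse must be exhibited:
  the Gram matrix of the dual family.\<close>

lemma inverse_on_gram:
  fixes W :: "nat \<Rightarrow> real^'n::finite"
  assumes fin: "finite J" and "inverse_bound J W B" and "i \<in> J" "j \<in> J"
  shows "(\<Sum>k\<in>J. (W i \<bullet> W k) * inverse_on J (\<lambda>i k. W i \<bullet> W k) k j) = (if i = j then 1 else 0)"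
proof -
  obtain X where XS: "\<And>j. j \<in> J \<Longrightarrow> X j \<in> span (W ` J)"
    and X: "\<And>i j. i \<in> J \<Longrightarrow> j \<in> J \<Longrightarrow> W i \<bullet> X j = (if i = j then 1 else 0)"
    using dual_family_exists[OF fin inverse_bound_kernel[OF assms(1,2)]] by metis
  have "\<exists>c. j \<in> J \<longrightarrow> X j = mult_vec J W c" for j
    using XS[of j] by (auto simp: span_image_eq_range_mult_vec[OF fin])
  then obtain N where N: "\<And>j. j \<in> J \<Longrightarrow> X j = mult_vec J W (N j)" by metis
  \<comment> \<open>The coefficients of the dual vectors are their mutual inner products. Hence
    \<open>N\<close> is symmetric, and the right inverse is also a left inverse.\<close>
  have XX: "X i \<bullet> X j = N i j" if "i \<in> J" "j \<in> J" for i j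
    using that fin by (simp add: N[OF that(1)] mult_vec_def inner_sum_left X if_distrib[of "(*) _"] cong: if_cong)
  have sym: "N i j = N j i" if "i \<in> J" "j \<in> J" for i j
    using that XX by (metis inner_commute)
  have r: "(\<Sum>k\<in>J. (W i \<bullet> W k) * N j k) = (if i = j then 1 else 0)" if "i \<in> J" "j \<in> J" for i j
    using X[OF that] by (simp add: N[OF that(2)] mult_vec_def inner_sum_right mult.commute)
  have l: "(\<Sum>k\<in>J. N k i * (W k \<bullet> W j)) = (if i = j then 1 else 0)" if "i \<in> J" "j \<in> J" for i j
  proof -
    have "(\<Sum>k\<in>J. N k i * (W k \<bullet> W j)) = (\<Sum>k\<in>J. (W j \<bullet> W k) * N i k)"
      using sym that by (intro sum.cong) (auto simp: inner_commute)
    then show ?thesis using r[OF that(2,1)] by auto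
  qed
  have "\<exists>N. \<forall>i\<in>J. \<forall>j\<in>J. (\<Sum>k\<in>J. (W i \<bullet> W k) * N k j) = (if i = j then 1 else 0) \<and>
     (\<Sum>k\<in>J. N i k * (W k \<bullet> W j)) = (if i = j then 1 else 0)"
    using l r sym by (intro exI[of _ "\<lambda>k j. N j k"]) simp
  from someI_ex[OF this] show ?thesis
    using assms(3,4) unfolding inverse_on_def by blast
qed

text \<open>These are the normal equations of least squares; the later estimates on
  \<open>V_component\<close> rest on this property.\<close>

lemma V_component_residual_orthogonal:
  fixes W :: "nat \<Rightarrow> real^'n::finite"
  assumes fin: "finite J" and "inverse_bound J W B"
  shows "mult_vec J W c \<bullet> (x - mult_vec J W (V_component J W x)) = 0"
proof -
  have "W i \<bullet> mult_vec J W (V_component J W x) = W i \<bullet> x" if "i \<in> J" for i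
  proof -
    have "W i \<bullet> mult_vec J W (V_component J W x)
        = (\<Sum>k\<in>J. \<Sum>l\<in>J. (W i \<bullet> W k) * inverse_on J (\<lambda>i k. W i \<bullet> W k) k l * (W l \<bullet> x))"
      by (simp add: mult_vec_def V_component_def transpose_mult_vec_def inner_sum_right
          sum_distrib_left sum_distrib_right mult_ac)
    also have "\<dots> = (\<Sum>l\<in>J. (\<Sum>k\<in>J. (W i \<bullet> W k) * inverse_on J (\<lambda>i k. W i \<bullet> W k) k l) * (W l \<bullet> x))"
      by (subst sum.swap) (simp add: sum_distrib_right)
    also have "\<dots> = (\<Sum>l\<in>J. (if i = l then 1 else 0) * (W l \<bullet> x))"
      using inverse_on_gram[OF assms that] by (intro sum.cong) auto
    also have "\<dots> = W i \<bullet> x" using fin that by (simp add: if_distrib[of "\<lambda>t. t * _"] cong: if_cong)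
    finally show ?thesis .
  qed
  then show ?thesis
    by (simp add: mult_vec_def inner_sum_left inner_diff_right)
qed

section \<open>Stability under perturbation of the columns\<close>

lemma norm_mult_vec_perturb:
  assumes "\<And>j. j \<in> J \<Longrightarrow> norm (W j - V j) \<le> \<delta>"
  shows "norm (mult_vec J W c - mult_vec J V c) \<le> \<delta> * (\<Sum>j\<in>J. \<bar>c j\<bar>)"
proof -
  have "norm (mult_vec J W c - mult_vec J V c) = norm (\<Sum>j\<in>J. c j *\<^sub>R (W j - V j))"
    by (simp add: mult_vec_def scaleR_diff_right sum_subtractf)
  also have "\<dots> \<le> (\<Sum>j\<in>J. \<delta> * \<bar>c j\<bar>)"
    by (rule sum_norm_le) (use assms in \<open>simp add: mult.commute[of \<delta>] mult_left_mono\<close>)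
  finally show ?thesis by (simp add: sum_distrib_left)
qed

text \<open>Replacing \<open>V\<close> by \<open>W\<close> costs at most B\<delta> times the
  coefficient sum. Since B\<delta> is at most 1/2, this is absorbed on the left, and the bound
  doubles.\<close>

lemma inverse_bound_perturb:
  assumes V: "inverse_bound J V B" and W: "\<And>j. j \<in> J \<Longrightarrow> norm (W j - V j) \<le> \<delta>" and B: "B * \<delta> \<le> 1 / 2"
  shows "inverse_bound J W (2 * B)"
  unfolding inverse_bound_def
proof (intro conjI allI)
  fix c :: "nat \<Rightarrow> real"
  let ?s = "\<Sum>j\<in>J. \<bar>c j\<bar>"
  have B0: "B \<ge> 0" and le: "?s \<le> B * norm (mult_vec J V c)" using V by (auto simp: inverse_bound_def)
  have "norm (mult_vec J V c) \<le> norm (mult_vec J W c) + \<delta> * ?s"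
    using norm_mult_vec_perturb[of J W V \<delta> c, OF W] norm_triangle_ineq3[of "mult_vec J W c" "mult_vec J V c"] by linarith
  then have "?s \<le> B * (norm (mult_vec J W c) + \<delta> * ?s)"
    using le B0 by (meson mult_left_mono order_trans)
  also have "\<dots> = B * norm (mult_vec J W c) + (B * \<delta>) * ?s" by (simp add: algebra_simps)
  also have "\<dots> \<le> B * norm (mult_vec J W c) + 1 / 2 * ?s"
    using B by (intro add_left_mono mult_right_mono) (auto intro: sum_nonneg)
  finally show "?s \<le> 2 * B * norm (mult_vec J W c)" by simp
qed (use V in \<open>simp add: inverse_bound_def\<close>)

text \<open>The image \<open>y\<close> of the coefficient error under \<open>W\<close> is tested
  against itself in the normal equations. Each resulting term is at most a constant times \<delta>
  times \<open>norm y\<close>, and one factor \<open>norm y\<close> cancels.\<close>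

lemma V_component_perturb:
  fixes V W :: "nat \<Rightarrow> real^'n::finite"
  assumes fin: "finite J" and V: "inverse_bound J V B"
    and W: "\<And>j. j \<in> J \<Longrightarrow> norm (W j - V j) \<le> \<delta>" and B: "B * \<delta> \<le> 1 / 2"
    and g: "norm (g' - g) \<le> \<delta>"
  shows "L2_set (\<lambda>j. V_component J W g' j - V_component J V g j) J
    \<le> 2 * B * (1 + 2 * B * norm (g - mult_vec J V (V_component J V g)) + (\<Sum>j\<in>J. \<bar>V_component J V g j\<bar>)) * \<delta>"
proof -
  define c where "c = V_component J V g"
  define c' where "c' = V_component J W g'"
  define e where "e j = c' j - c j" for j
  define y where "y = mult_vec J W e"
  define r where "r = g - mult_vec J V c"
  define s where "s = (\<Sum>j\<in>J. \<bar>e j\<bar>)"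
  define K where "K = 1 + 2 * B * norm r + (\<Sum>j\<in>J. \<bar>c j\<bar>)"
  have B0: "B \<ge> 0" using V by (simp add: inverse_bound_def)
  have \<delta>0: "\<delta> \<ge> 0" using g norm_ge_zero order_trans by blast
  have W2: "inverse_bound J W (2 * B)" by (rule inverse_bound_perturb[OF V W B])
  have s: "s \<le> 2 * B * norm y" using W2 by (simp add: inverse_bound_def s_def y_def)
  have yeq: "y = mult_vec J W c' - mult_vec J W c"
    by (simp add: y_def e_def mult_vec_def scaleR_diff_left sum_subtractf)
  have o1: "y \<bullet> (g' - mult_vec J W c') = 0"
    unfolding y_def c'_def by (rule V_component_residual_orthogonal[OF fin W2])
  have o2: "mult_vec J V e \<bullet> r = 0"
    unfolding r_def c_def by (rule V_component_residual_orthogonal[OF fin V])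
  \<comment> \<open>By \<open>o1\<close>, \<open>y\<close> has the same inner product with
    \<open>g'\<close> as with \<open>mult_vec J W c'\<close>; the rest is inserting \<open>g\<close>
    and \<open>mult_vec J V c\<close>.\<close>
  have "y \<bullet> y = y \<bullet> (g' - g) + y \<bullet> r + y \<bullet> (mult_vec J V c - mult_vec J W c)"
    using o1 unfolding r_def inner_add_right[symmetric] by (subst (2) yeq) (simp add: inner_diff_right)
  \<comment> \<open>The residual \<open>r\<close> need not be small, but it is orthogonal to the
    columns of \<open>V\<close>. Only the O(\<delta>) difference between \<open>y\<close> and
    \<open>mult_vec J V e\<close> contributes.\<close>
  also have "y \<bullet> r = (y - mult_vec J V e) \<bullet> r" using o2 by (simp add: inner_diff_left)
  also have "\<bar>y \<bullet> (g' - g)\<bar> \<le> norm y * \<delta>"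
    using g by (intro order_trans[OF Cauchy_Schwarz_ineq2] mult_left_mono) auto
  then have "y \<bullet> (g' - g) \<le> norm y * \<delta>" by simp
  also have "(y - mult_vec J V e) \<bullet> r \<le> \<delta> * (2 * B * norm y) * norm r"
  proof -
    have "norm (y - mult_vec J V e) \<le> \<delta> * s"
      unfolding y_def s_def by (rule norm_mult_vec_perturb[OF W])
    also have "\<dots> \<le> \<delta> * (2 * B * norm y)" using s \<delta>0 by (rule mult_left_mono)
    finally show ?thesis
      by (intro order_trans[OF norm_cauchy_schwarz] mult_right_mono) auto
  qed
  also have "y \<bullet> (mult_vec J V c - mult_vec J W c) \<le> norm y * (\<delta> * (\<Sum>j\<in>J. \<bar>c j\<bar>))"
    using norm_mult_vec_perturb[of J W V \<delta> c, OF W]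
    by (intro order_trans[OF norm_cauchy_schwarz] mult_left_mono) (auto simp: norm_minus_commute)
  finally have "norm y * norm y \<le> norm y * (K * \<delta>)"
    by (simp add: K_def dot_square_norm power2_eq_square algebra_simps)
  then have "norm y \<le> K * \<delta>"
  proof (cases "y = 0")
    case True
    have "K \<ge> 0" using B0 by (simp add: K_def add_nonneg_nonneg sum_nonneg)
    then show ?thesis using True \<delta>0 by simp
  qed (simp add: mult_le_cancel_left_pos)
  then have "s \<le> 2 * B * (K * \<delta>)" using s B0 by (meson mult_left_mono mult_nonneg_nonneg order_trans zero_le_numeral)
  moreover have "L2_set e J \<le> s" unfolding s_def by (rule L2_set_le_sum_abs)
  ultimately show ?thesis
    unfolding e_def c_def c'_def K_def r_def by (simp add: mult.assoc)
qed

text \<open>\<open>p\<close> is the orthogonal projection of \<open>u\<close>. The discarded part is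
  a combination of the columns of \<open>W\<close>; \<open>u\<close> is orthogonal to the same
  combination of the columns of \<open>V\<close>, so the discarded part is small.\<close>

lemma null_space_transpose_approx:
  fixes V W :: "nat \<Rightarrow> real^'n::finite"
  assumes fin: "finite J" and bd: "inverse_bound J W B"
    and W: "\<And>j. j \<in> J \<Longrightarrow> norm (W j - V j) \<le> \<delta>" and \<delta>0: "\<delta> \<ge> 0"
    and u: "u \<in> null_space_transpose J V" "norm u \<le> 1"
  shows "\<exists>p\<in>null_space_transpose J W. norm (u - p) \<le> B * \<delta>"
proof -
  obtain y z where y: "y \<in> span (W ` J)" and z: "\<And>w. w \<in> span (W ` J) \<Longrightarrow> orthogonal z w"
    and uyz: "u = y + z"
    using orthogonal_subspace_decomp_exists[of "W ` J" u] by blast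
  obtain c where c: "y = mult_vec J W c" using y by (auto simp: span_image_eq_range_mult_vec[OF fin])
  have "mult_vec J V c \<bullet> u = 0"
    using u(1) by (simp add: mult_vec_def inner_sum_left null_space_transpose_def transpose_mult_vec_def)
  then have "y \<bullet> y = (mult_vec J W c - mult_vec J V c) \<bullet> u"
    using z[OF y] by (simp add: uyz inner_diff_left orthogonal_def inner_add_right c[symmetric] inner_commute[of y z])
  also have "\<dots> \<le> norm (mult_vec J W c - mult_vec J V c) * 1"
    using u(2) by (intro order_trans[OF norm_cauchy_schwarz] mult_left_mono) auto
  also have "\<dots> \<le> \<delta> * (\<Sum>j\<in>J. \<bar>c j\<bar>)" using norm_mult_vec_perturb[of J W V \<delta> c, OF W] by simp
  also have "\<dots> \<le> \<delta> * (B * norm y)" using bd \<delta>0 c by (intro mult_left_mono) (auto simp: inverse_bound_def)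
  finally have "norm y * norm y \<le> norm y * (B * \<delta>)"
    by (simp add: dot_square_norm power2_eq_square mult_ac)
  then have "norm y \<le> B * \<delta>"
    using bd \<delta>0 by (cases "y = 0") (auto simp: inverse_bound_def mult_le_cancel_left_pos)
  moreover have "z \<in> null_space_transpose J W"
    using z by (simp add: null_space_transpose_eq orthogonal_commute)
  ultimately show ?thesis using uyz by (intro bexI[of _ z]) auto
qed

section \<open>Orthonormal bases and Gram--Schmidt\<close>

text \<open>Gram--Schmidt with error control, by induction on \<open>k\<close>. The constant is
  quantified before \<open>U\<close>, \<open>S\<close> and \<eta>, so that one value serves all
  bases and all perturbed null spaces.\<close>

lemma orthonormal_near_subspace:
  "\<exists>C\<ge>0. \<forall>(U :: nat \<Rightarrow> 'a::euclidean_space) S \<eta>. subspace S \<longrightarrow>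
     (\<forall>a<k. \<forall>b<k. U a \<bullet> U b = (if a = b then 1 else 0)) \<longrightarrow>
     (\<forall>a<k. \<exists>p\<in>S. norm (U a - p) \<le> \<eta>) \<longrightarrow> C * \<eta> < 1 \<longrightarrow> \<eta> \<ge> 0 \<longrightarrow>
     (\<exists>W. (\<forall>a<k. W a \<in> S \<and> norm (W a - U a) \<le> C * \<eta>) \<and>
          (\<forall>a<k. \<forall>b<k. W a \<bullet> W b = (if a = b then 1 else 0)))"
proof (induction k)
  case 0
  show ?case by (intro exI[of _ 0]) auto
next
  case (Suc k)
  then obtain C where C0: "C \<ge> 0" and C: "\<And>(U :: nat \<Rightarrow> 'a) S \<eta>. subspace S \<Longrightarrow>
     \<forall>a<k. \<forall>b<k. U a \<bullet> U b = (if a = b then 1 else 0) \<Longrightarrow>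
     \<forall>a<k. \<exists>p\<in>S. norm (U a - p) \<le> \<eta> \<Longrightarrow> C * \<eta> < 1 \<Longrightarrow> \<eta> \<ge> 0 \<Longrightarrow>
     \<exists>W. (\<forall>a<k. W a \<in> S \<and> norm (W a - U a) \<le> C * \<eta>) \<and>
          (\<forall>a<k. \<forall>b<k. W a \<bullet> W b = (if a = b then 1 else 0))"
    by blast
  \<comment> \<open>Orthogonalising the new vector and normalising it each cost at most
    \<open>E\<close> (defined below), whence the factor 2; the summand \<open>C\<close> preserves
    the bounds for earlier vectors.\<close>
  define D where "D = 2 * (1 + real k * (C + 1)) + C"
  have CD: "C \<le> D" and D0: "D \<ge> 0" using C0 by (auto simp: D_def)
  show ?case
  proof (intro exI[of _ D] conjI allI impI)
    show "D \<ge> 0" by (rule D0)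
    fix U :: "nat \<Rightarrow> 'a" and S \<eta>
    assume S: "subspace S" and U: "\<forall>a<Suc k. \<forall>b<Suc k. U a \<bullet> U b = (if a = b then 1 else 0)"
      and near: "\<forall>a<Suc k. \<exists>p\<in>S. norm (U a - p) \<le> \<eta>" and small: "D * \<eta> < 1" and \<eta>0: "\<eta> \<ge> 0"
    have CD': "C * \<eta> \<le> D * \<eta>" using CD \<eta>0 by (rule mult_right_mono)
    then have "C * \<eta> < 1" using small by simp
    then obtain W where WS: "\<And>a. a < k \<Longrightarrow> W a \<in> S" and WU: "\<And>a. a < k \<Longrightarrow> norm (W a - U a) \<le> C * \<eta>"
      and WW: "\<And>a b. a < k \<Longrightarrow> b < k \<Longrightarrow> W a \<bullet> W b = (if a = b then 1 else 0)"
      using C[of S U \<eta>] S U near \<eta>0 by (metis less_Suc_eq)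
    obtain p where p: "p \<in> S" "norm (U k - p) \<le> \<eta>" using near by blast
    have Uk: "norm (U k) = 1" using U by (simp add: norm_eq_1)
    have nW: "norm (W a) = 1" if "a < k" for a using WW[OF that that] by (simp add: norm_eq_1)
    \<comment> \<open>\<open>U a\<close> and \<open>U k\<close> are orthogonal, and
      \<open>W a\<close> and \<open>p\<close> are close to them.\<close>
    have Wp: "\<bar>W a \<bullet> p\<bar> \<le> (C + 1) * \<eta>" if a: "a < k" for a
    proof -
      have "W a \<bullet> p = (W a - U a) \<bullet> U k - W a \<bullet> (U k - p)"
        using U a by (simp add: inner_diff_left inner_diff_right)
      moreover have "\<bar>(W a - U a) \<bullet> U k\<bar> \<le> C * \<eta>"
        using Cauchy_Schwarz_ineq2[of "W a - U a" "U k"] WU[OF a] Uk by simp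
      moreover have "\<bar>W a \<bullet> (U k - p)\<bar> \<le> \<eta>"
        using Cauchy_Schwarz_ineq2[of "W a" "U k - p"] nW[OF a] p by simp
      ultimately show ?thesis by (simp add: algebra_simps)
    qed
    define q where "q = p - (\<Sum>a<k. (W a \<bullet> p) *\<^sub>R W a)"
    have qS: "q \<in> S" unfolding q_def
      using S p WS by (intro subspace_diff subspace_sum subspace_scale) auto
    have Wq: "W b \<bullet> q = 0" if "b < k" for b
    proof -
      have "W b \<bullet> (\<Sum>a<k. (W a \<bullet> p) *\<^sub>R W a) = (\<Sum>a<k. (W a \<bullet> p) * (if b = a then 1 else 0))"
        unfolding inner_sum_right using WW that by (intro sum.cong) auto
      also have "\<dots> = W b \<bullet> p" using that by (simp add: if_distrib[of "(*) _"] cong: if_cong)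
      finally show ?thesis by (simp add: q_def inner_diff_right)
    qed
    define E where "E = (1 + real k * (C + 1)) * \<eta>"
    have qU: "norm (q - U k) \<le> E"
    proof -
      have "norm (\<Sum>a<k. (W a \<bullet> p) *\<^sub>R W a) \<le> (\<Sum>a<k. (C + 1) * \<eta>)"
        using Wp nW by (intro sum_norm_le) auto
      moreover have "norm (q - U k) \<le> norm (U k - p) + norm (\<Sum>a<k. (W a \<bullet> p) *\<^sub>R W a)"
        using norm_triangle_ineq4[of "p - U k" "\<Sum>a<k. (W a \<bullet> p) *\<^sub>R W a"]
        by (simp add: q_def norm_minus_commute[of "U k"] algebra_simps)
      ultimately show ?thesis using p(2) by (simp add: E_def algebra_simps)
    qed
    have ED: "2 * E \<le> D * \<eta>" using C0 \<eta>0 by (simp add: E_def D_def algebra_simps)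
    have nq: "\<bar>norm q - 1\<bar> \<le> E" using norm_triangle_ineq3[of q "U k"] Uk qU by simp
    \<comment> \<open>From D\<eta> < 1 follows E < 1/2, so \<open>q\<close> can be
      normalised.\<close>
    have q0: "norm q > 0" using nq ED small by linarith
    define w where "w = q /\<^sub>R norm q"
    have "norm (w - q) = \<bar>norm q - 1\<bar>"
    proof -
      have "w - q = (1 / norm q - 1) *\<^sub>R q" by (simp add: w_def scaleR_diff_left divide_inverse)
      then have "norm (w - q) = \<bar>1 / norm q - 1\<bar> * norm q" by simp
      also have "\<dots> = \<bar>(1 / norm q - 1) * norm q\<bar>" by (simp add: abs_mult)
      also have "(1 / norm q - 1) * norm q = 1 - norm q" using q0 by (simp add: field_simps)
      finally show ?thesis by (simp add: abs_minus_commute)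
    qed
    then have wU: "norm (w - U k) \<le> D * \<eta>"
      using norm_triangle_ineq[of "w - q" "q - U k"] nq qU ED by simp
    define W' where "W' = W(k := w)"
    have "w \<bullet> w = 1" using q0 by (simp add: w_def dot_square_norm power2_eq_square)
    moreover have "W b \<bullet> w = 0" "w \<bullet> W b = 0" if "b < k" for b
      using Wq[OF that] by (simp_all add: w_def inner_commute)
    ultimately have "\<forall>a<Suc k. \<forall>b<Suc k. W' a \<bullet> W' b = (if a = b then 1 else 0)"
      using WW by (auto simp: W'_def less_Suc_eq)
    moreover have "\<forall>a<Suc k. W' a \<in> S \<and> norm (W' a - U a) \<le> D * \<eta>"
      using WS WU CD' wU qS S by (auto simp: W'_def less_Suc_eq w_def subspace_scale intro: order_trans)
    ultimately show "\<exists>W. (\<forall>a<Suc k. W a \<in> S \<and> norm (W a - U a) \<le> D * \<eta>) \<and>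
          (\<forall>a<Suc k. \<forall>b<Suc k. W a \<bullet> W b = (if a = b then 1 else 0))" by blast
  qed
qed

lemma orthonormal_independent:
  fixes U :: "nat \<Rightarrow> 'a::euclidean_space"
  assumes "\<forall>a<k. \<forall>b<k. U a \<bullet> U b = (if a = b then 1 else 0)"
  shows "inj_on U {..<k}" "independent (U ` {..<k})"
proof -
  show "inj_on U {..<k}"
    by (rule inj_onI) (metis assms lessThan_iff zero_neq_one)
  show "independent (U ` {..<k})"
  proof (rule pairwise_orthogonal_independent)
    show "pairwise orthogonal (U ` {..<k})"
      using assms by (auto simp: pairwise_def orthogonal_def)
    show "0 \<notin> U ` {..<k}" using assms by (metis (no_types, lifting) imageE inner_zero_left lessThan_iff zero_neq_one)
  qed
qed

lemma orthonormal_basis_matrix_dim: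
  assumes "orthonormal_basis_matrix k U S"
  shows "dim S = k"
  using assms orthonormal_independent[of k U]
  by (auto simp: orthonormal_basis_matrix_def dim_eq_card_independent card_image)

text \<open>The spanning property comes from counting: \<open>k\<close> independent vectors in a
  \<open>k\<close>-dimensional subspace span it.\<close>

lemma orthonormal_basis_matrixI:
  assumes S: "subspace S" "dim S = k" and U: "\<forall>a<k. \<forall>b<k. U a \<bullet> U b = (if a = b then 1 else 0)"
    and US: "\<And>a. a < k \<Longrightarrow> U a \<in> S"
  shows "orthonormal_basis_matrix k U S"
proof -
  have sub: "U ` {..<k} \<subseteq> S" using US by auto
  have "S \<subseteq> span (U ` {..<k})"
    using orthonormal_independent[OF U] sub S(2) by (intro card_ge_dim_independent) (auto simp: card_image)
  moreover have "span (U ` {..<k}) \<subseteq> S" using sub S(1) by (rule span_minimal)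
  ultimately show ?thesis using U by (auto simp: orthonormal_basis_matrix_def)
qed

lemma norm_mult_vec_orthonormal:
  assumes "\<forall>a<k. \<forall>b<k. U a \<bullet> U b = (if a = b then 1 else 0)"
  shows "norm (mult_vec {..<k} U u) = L2_set u {..<k}"
proof -
  have "mult_vec {..<k} U u \<bullet> mult_vec {..<k} U u = (\<Sum>a<k. \<Sum>b<k. u a * (u b * (U b \<bullet> U a)))"
    by (simp add: mult_vec_def inner_sum_left inner_sum_right sum_distrib_left)
  also have "\<dots> = (\<Sum>a<k. \<Sum>b<k. u a * (u b * (if a = b then 1 else 0)))"
    using assms by (intro sum.cong) auto
  also have "\<dots> = (\<Sum>a<k. (u a)\<^sup>2)"
    by (simp add: if_distrib[of "(*) _"] power2_eq_square cong: if_cong)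
  finally show ?thesis by (simp add: L2_set_def norm_eq_sqrt_inner)
qed

section \<open>The max-function at a point with affinely independent active gradients\<close>

text \<open>Let t tend to 0. This removes the second-order error along a ray after division by the
  step length.\<close>

lemma nonpos_if_eventually_le_linear:
  fixes a c :: real
  assumes "\<forall>\<^sub>F t in at_right 0. a \<le> c * t"
  shows "a \<le> 0"
proof -
  have "((\<lambda>t. c * t) \<longlongrightarrow> c * 0) (at_right 0)" by (intro tendsto_intros)
  from tendsto_lowerbound[OF this assms] show ?thesis by simp
qed

text \<open>The analysis is local to \<open>xb\<close>: smoothness is expressed by continuity and a
  quadratic error bound at \<open>xb\<close>, with one constant \<open>C\<close> for all
  pieces.\<close>

locale max_function_point =
  fixes f :: "real^'n::finite \<Rightarrow> real" and F :: "nat \<Rightarrow> real^'n \<Rightarrow> real" and m :: nat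
    and xb :: "real^'n" and C :: real
  assumes m_pos: "m \<ge> 1"
    and convex: "convex_on UNIV f"
    and f_Max: "\<And>x. f x = Max ((\<lambda>i. F i x) ` {1..m})"
    and F_continuous: "\<And>i. i \<in> {1..m} \<Longrightarrow> continuous_on UNIV (F i)"
    and C_nonneg: "C \<ge> 0"
    and F_expansion: "\<And>i. i \<in> {1..m} \<Longrightarrow> \<forall>\<^sub>F y in nhds xb.
        \<bar>F i y - F i xb - grad (F i) xb \<bullet> (y - xb)\<bar> \<le> C * (norm (y - xb))\<^sup>2"
    and active_independent: "affinely_independent_family (active f F m xb) (\<lambda>i. grad (F i) xb)"
begin

abbreviation "A \<equiv> active f F m xb"
abbreviation "I \<equiv> first_active f F m xb"
abbreviation "J \<equiv> V_indices f F m xb"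
abbreviation "V \<equiv> V_matrix f F m xb"
abbreviation "G i \<equiv> grad (F i) xb"

text \<open>The equal weights match the average formed by the subroutine, and their positivity
  places \<open>g\<close> in the relative interior.\<close>

definition g :: "real^'n" where "g = (1 / real (card A)) *\<^sub>R (\<Sum>i\<in>A. G i)"

lemma F_le_f: "i \<in> {1..m} \<Longrightarrow> F i y \<le> f y"
  unfolding f_Max by simp

lemma f_attained: "\<exists>i\<in>{1..m}. f y = F i y"
proof -
  have "Max ((\<lambda>i. F i y) ` {1..m}) \<in> (\<lambda>i. F i y) ` {1..m}" using m_pos by (intro Max_in) auto
  then show ?thesis by (auto simp: f_Max)
qed

lemma finite_A: "finite A" and finite_J: "finite J"
  by (auto simp: V_indices_def active_def)

lemma A_nonempty: "A \<noteq> {}"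
  using f_attained[of xb] by (auto simp: active_def)

lemma card_A_pos: "card A > 0"
  using finite_A A_nonempty by (simp add: card_gt_0_iff)

lemma I_in_A: "I \<in> A" using finite_A A_nonempty by simp

lemma A_eq: "A = insert I J" and I_notin_J: "I \<notin> J"
  using I_in_A unfolding V_indices_def by blast+

lemma sum_A: "sum h A = h I + sum h J" for h :: "nat \<Rightarrow> 'b::comm_monoid_add"
proof -
  have "sum h A = sum h (insert I J)" by (rule arg_cong[OF A_eq])
  then show ?thesis using finite_J I_notin_J by simp
qed

lemma activeD: "i \<in> A \<Longrightarrow> i \<in> {1..m}" "i \<in> A \<Longrightarrow> F i xb = f xb"
  by (auto simp: active_def)

lemma f_continuous: "continuous_on UNIV f"
  by (rule convex_on_continuous) (auto intro: convex)

text \<open>Inactive pieces lie strictly below \<open>f\<close> at \<open>xb\<close>, and by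
  continuity also nearby, so the maximum there is attained by a piece active at
  \<open>xb\<close>.\<close>

lemma eventually_active: "\<forall>\<^sub>F y in nhds xb. \<exists>i\<in>A. f y = F i y"
proof -
  have "\<forall>\<^sub>F y in nhds xb. i \<in> {1..m} - A \<longrightarrow> F i y < f y" for i
  proof (cases "i \<in> {1..m} - A")
    case True
    have "continuous (at xb) (\<lambda>y. f y - F i y)"
      using f_continuous F_continuous[of i] True
      by (intro continuous_intros) (auto simp: continuous_on_eq_continuous_at)
    then have "((\<lambda>y. f y - F i y) \<longlongrightarrow> f xb - F i xb) (nhds xb)"
      using tendsto_at_iff_tendsto_nhds[of "\<lambda>y. f y - F i y" xb] by (simp add: isCont_def)
    moreover have "f xb - F i xb > 0"
      using True F_le_f[of i xb] by (auto simp: active_def)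
    ultimately have "\<forall>\<^sub>F y in nhds xb. f y - F i y > 0" by (rule order_tendstoD(1))
    then show ?thesis by eventually_elim simp
  qed auto
  then have "\<forall>\<^sub>F y in nhds xb. \<forall>i\<in>{1..m}. i \<in> {1..m} - A \<longrightarrow> F i y < f y"
    by (intro eventually_ball_finite) auto
  then show ?thesis
    by eventually_elim (metis DiffI f_attained less_irrefl)
qed

text \<open>The index is that of the active piece attaining \<open>f y\<close>, so it depends on
  \<open>y\<close>.\<close>

lemma eventually_f_le:
  "\<forall>\<^sub>F y in nhds xb. \<exists>i\<in>A. f y \<le> f xb + G i \<bullet> (y - xb) + C * (norm (y - xb))\<^sup>2"
proof -
  have "\<forall>\<^sub>F y in nhds xb. \<forall>i\<in>{1..m}.
      \<bar>F i y - F i xb - grad (F i) xb \<bullet> (y - xb)\<bar> \<le> C * (norm (y - xb))\<^sup>2"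
    using F_expansion by (intro eventually_ball_finite) auto
  with eventually_active show ?thesis
  proof eventually_elim
    case (elim y)
    then obtain i where i: "i \<in> A" "f y = F i y" by blast
    have "\<bar>F i y - F i xb - G i \<bullet> (y - xb)\<bar> \<le> C * (norm (y - xb))\<^sup>2" using elim activeD[OF i(1)] by blast
    then show ?case using i activeD(2)[OF i(1)] by (intro bexI[of _ i]) auto
  qed
qed

lemma filterlim_ray: "filterlim (\<lambda>t. xb + t *\<^sub>R d) (nhds xb) (at_right (0::real))"
proof -
  have "((\<lambda>t. xb + t *\<^sub>R d) \<longlongrightarrow> xb + 0 *\<^sub>R d) (at_right (0::real))" by (intro tendsto_intros)
  then show ?thesis by simp
qed

section \<open>Subdifferential, relative interior and \<V>-space\<close>

text \<open>The pieces themselves need not be convex. Convexity of \<open>f\<close> bounds it from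
  above on the segment from \<open>xb\<close> to \<open>y\<close>, the expansion of the active piece
  bounds it from below; divide by t and let t tend to 0.\<close>

lemma active_gradient_subgradient:
  assumes i: "i \<in> A"
  shows "G i \<in> subdifferential f xb"
  unfolding subdifferential_def
proof (intro CollectI allI)
  fix y
  define d where "d = y - xb"
  have "\<forall>\<^sub>F t in at_right (0::real). t < 1" by (rule eventually_at_right_real[of 0 1, simplified, THEN eventually_mono]) auto
  with eventually_at_right_less[of "0::real"]
    filterlim_iff[THEN iffD1, OF filterlim_ray[of d], rule_format, OF F_expansion[OF activeD(1)[OF i]]]
  have "\<forall>\<^sub>F t in at_right 0. f xb + G i \<bullet> d - f y \<le> C * (norm d)\<^sup>2 * t"
  proof eventually_elim
    case (elim t)
    have "f ((1 - t) *\<^sub>R xb + t *\<^sub>R y) \<le> (1 - t) * f xb + t * f y"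
      using elim by (intro convex_onD[OF convex]) auto
    moreover have "(1 - t) *\<^sub>R xb + t *\<^sub>R y = xb + t *\<^sub>R d" by (simp add: d_def algebra_simps)
    moreover have "F i (xb + t *\<^sub>R d) \<le> f (xb + t *\<^sub>R d)" by (rule F_le_f[OF activeD(1)[OF i]])
    moreover have "F i (xb + t *\<^sub>R d) \<ge> f xb + t * (G i \<bullet> d) - C * (t\<^sup>2 * (norm d)\<^sup>2)"
      using elim(2) activeD(2)[OF i] elim by (simp add: power_mult_distrib abs_le_iff)
    ultimately have "t * (f xb + G i \<bullet> d - f y) \<le> t * (C * (norm d)\<^sup>2 * t)"
      by (simp add: algebra_simps power2_eq_square)
    then show ?case using elim by simp
  qed
  from nonpos_if_eventually_le_linear[OF this]
  show "f y \<ge> f xb + G i \<bullet> (y - xb)" by (simp add: d_def)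
qed

lemma subdifferential_eq: "subdifferential f xb = convex hull (G ` A)"
proof
  have "convex (subdifferential f xb)"
  proof (rule convexI)
    fix s t :: "real^'n" and u v :: real
    assume st: "s \<in> subdifferential f xb" "t \<in> subdifferential f xb" and uv: "u \<ge> 0" "v \<ge> 0" "u + v = 1"
    have "f xb + (u *\<^sub>R s + v *\<^sub>R t) \<bullet> (y - xb) \<le> f y" for y
    proof -
      have "u * (f xb + s \<bullet> (y - xb)) + v * (f xb + t \<bullet> (y - xb)) \<le> u * f y + v * f y"
        using st uv by (intro add_mono mult_left_mono) (auto simp: subdifferential_def)
      moreover have "u * f y + v * f y = f y" "u * f xb + v * f xb = f xb"
        using uv by (simp_all add: distrib_right[symmetric])
      ultimately show ?thesis by (simp add: inner_add_left algebra_simps)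
    qed
    then show "u *\<^sub>R s + v *\<^sub>R t \<in> subdifferential f xb" by (simp add: subdifferential_def)
  qed
  then show "convex hull (G ` A) \<subseteq> subdifferential f xb"
    by (intro hull_minimal) (auto intro: active_gradient_subgradient)
  show "subdifferential f xb \<subseteq> convex hull (G ` A)"
  proof (rule subsetI, rule ccontr)
    fix s assume s: "s \<in> subdifferential f xb" and "s \<notin> convex hull (G ` A)"
    moreover have "closed (convex hull (G ` A))"
      by (intro compact_imp_closed finite_imp_compact_convex_hull) (use finite_A in auto)
    ultimately obtain a b where ab: "a \<bullet> s < b" "\<forall>x\<in>convex hull (G ` A). a \<bullet> x > b"
      using separating_hyperplane_closed_point[of "convex hull (G ` A)" s] by auto
    have Gb: "a \<bullet> G i > b" if "i \<in> A" for i using ab(2) that by (simp add: hull_inc)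
    \<comment> \<open>Moving from \<open>xb\<close> in direction \<open>- a\<close>,
      \<open>f\<close> falls to first order at a rate above \<open>b\<close>, while the subgradient
      \<open>s\<close> permits a rate of at most \<open>a \<bullet> s\<close>, which is below
      \<open>b\<close>.\<close>
    from eventually_at_right_less[of "0::real"]
      filterlim_iff[THEN iffD1, OF filterlim_ray[of "- a"], rule_format, OF eventually_f_le]
    have "\<forall>\<^sub>F t in at_right 0. b - a \<bullet> s \<le> C * (norm a)\<^sup>2 * t"
    proof eventually_elim
      case (elim t)
      then obtain i where i: "i \<in> A"
        and le: "f (xb + t *\<^sub>R (- a)) \<le> f xb - t * (G i \<bullet> a) + C * (t\<^sup>2 * (norm a)\<^sup>2)"
        by (auto simp: power_mult_distrib)
      have "f (xb + t *\<^sub>R (- a)) \<ge> f xb + s \<bullet> (t *\<^sub>R (- a))"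
        using s unfolding subdifferential_def by (metis (mono_tags, lifting) add_diff_cancel_left' mem_Collect_eq)
      with le have "t * (G i \<bullet> a - s \<bullet> a) \<le> t * (C * (norm a)\<^sup>2 * t)"
        by (simp add: algebra_simps power2_eq_square)
      then have "G i \<bullet> a - s \<bullet> a \<le> C * (norm a)\<^sup>2 * t" using elim by simp
      then show ?case using Gb[OF i] by (simp add: inner_commute)
    qed
    from nonpos_if_eventually_le_linear[OF this] ab(1) show False by simp
  qed
qed

text \<open>Affine independence of the indexed family excludes repeated gradients, so sums over
  \<open>A\<close> may be read as sums over the set of gradients.\<close>

lemma inj_on_G: "inj_on G A"
proof (rule inj_onI, rule ccontr)
  fix i j assume ij: "i \<in> A" "j \<in> A" "G i = G j" "i \<noteq> j"
  define c :: "nat \<Rightarrow> real" where "c l = (if l = i then 1 else 0) - (if l = j then 1 else 0)" for l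
  have "(\<Sum>l\<in>A. c l *\<^sub>R G l) = 0"
    using ij finite_A
    by (simp add: c_def scaleR_diff_left sum_subtractf if_distrib[of "\<lambda>t. t *\<^sub>R _"] cong: if_cong)
  moreover have "(\<Sum>l\<in>A. c l) = 0" using ij finite_A by (simp add: c_def sum_subtractf)
  ultimately have "c i = 0" using active_independent ij(1) unfolding affinely_independent_family_def by blast
  then show False using ij by (simp add: c_def)
qed

text \<open>A convex combination of the generators with all weights positive is a relative interior
  point of their hull.\<close>

lemma g_rel_interior: "g \<in> rel_interior (subdifferential f xb)"
proof -
  have "(\<Sum>x\<in>G ` A. (1 / real (card A)) *\<^sub>R x) = g"
    using inj_on_G by (simp add: g_def sum.reindex scaleR_sum_right)
  moreover have "(\<Sum>x\<in>G ` A. 1 / real (card A)) = 1"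
    using card_A_pos inj_on_G by (simp add: card_image)
  ultimately have "g \<in> {y. \<exists>u. (\<forall>x \<in> G ` A. 0 < u x) \<and> sum u (G ` A) = 1 \<and> sum (\<lambda>x. u x *\<^sub>R x) (G ` A) = y}"
    using card_A_pos by (intro CollectI exI[of _ "\<lambda>_. 1 / real (card A)"]) auto
  then show ?thesis
    unfolding subdifferential_eq
    using explicit_subset_rel_interior_convex_hull_minimal[of "G ` A"] finite_A by blast
qed

lemma g_subgradient: "g \<in> subdifferential f xb"
  using g_rel_interior rel_interior_subset by blast

text \<open>Differences from \<open>g\<close> and differences from \<open>G I\<close> span the same
  space, because \<open>g\<close> and \<open>G I\<close> are both subgradients and the reference
  point cancels.\<close>

lemma V_space_eq: "V_space f xb g = span (V ` J)"
proof -
  let ?T = "{s. s - G I \<in> span (V ` J)}"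
  have "convex ?T"
  proof (rule convexI)
    fix s t and a b :: real
    assume st: "s \<in> ?T" "t \<in> ?T" and ab: "a + b = 1"
    have "a *\<^sub>R (s - G I) + b *\<^sub>R (t - G I) = a *\<^sub>R s + b *\<^sub>R t - (a + b) *\<^sub>R G I"
      by (simp add: algebra_simps)
    then have "a *\<^sub>R s + b *\<^sub>R t - G I = a *\<^sub>R (s - G I) + b *\<^sub>R (t - G I)" using ab by simp
    then show "a *\<^sub>R s + b *\<^sub>R t \<in> ?T"
      using st by (auto intro!: span_add span_scale)
  qed
  moreover have "G ` A \<subseteq> ?T"
  proof (rule image_subsetI)
    fix i assume "i \<in> A"
    then consider "i = I" | "i \<in> J" using A_eq by blast
    then show "G i \<in> ?T"
    proof cases
      case 2
      then have "V i \<in> span (V ` J)" by (intro span_base imageI)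
      then show ?thesis by (simp add: V_matrix_def)
    qed (simp add: span_zero)
  qed
  ultimately have T: "subdifferential f xb \<subseteq> ?T"
    unfolding subdifferential_eq by (intro hull_minimal)
  have "s - g \<in> span (V ` J)" if "s \<in> subdifferential f xb" for s
  proof -
    have "s - G I \<in> span (V ` J)" "g - G I \<in> span (V ` J)" using T that g_subgradient by blast+
    from span_diff[OF this] show ?thesis by simp
  qed
  then have 1: "V_space f xb g \<subseteq> span (V ` J)"
    unfolding V_space_def by (intro span_minimal) auto
  have "V j \<in> V_space f xb g" if "j \<in> J" for j
  proof -
    have G: "G i - g \<in> V_space f xb g" if "i \<in> A" for i
      unfolding V_space_def using that by (intro span_base imageI active_gradient_subgradient)
    then have "(G j - g) - (G I - g) \<in> V_space f xb g"
      using G[of j] G[OF I_in_A] that A_eq unfolding V_space_def by (intro span_diff[of "G j - g"]) blast+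
    then show ?thesis by (simp add: V_matrix_def)
  qed
  then have "span (V ` J) \<subseteq> V_space f xb g"
    by (intro span_minimal image_subsetI) (simp_all add: V_space_def)
  with 1 show ?thesis by simp
qed

section \<open>The \<U>-space and the \<U>-Lagrangian\<close>

lemma U_space_eq: "U_space f xb g = null_space_transpose J V"
  unfolding U_space_def V_space_eq orthogonal_comp_def null_space_transpose_eq by simp

text \<open>Along \<U> the active pieces agree to first order, since their gradients differ from
  \<open>g\<close> by vectors of \<V>. This makes \<open>f\<close> differentiable at
  \<open>xb\<close> along \<U>.\<close>

lemma gradient_inner_U:
  assumes "i \<in> A" "u \<in> null_space_transpose J V"
  shows "G i \<bullet> u = g \<bullet> u"
proof -
  have "G i - g \<in> span (V ` J)"
    unfolding V_space_eq[symmetric] V_space_def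
    using assms by (intro span_base imageI active_gradient_subgradient)
  then show ?thesis
    using assms(2) by (auto simp: null_space_transpose_eq orthogonal_def inner_diff_left)
qed

text \<open>Since \<open>g\<close> lies in the relative interior, \<open>g + \<eta> y / \<parallel>y\<parallel>\<close> is still a subgradient.\<close>

lemma f_growth_along_V:
  "\<exists>\<eta>>0. \<forall>u\<in>null_space_transpose J V. \<forall>y\<in>span (V ` J).
     f (xb + u + y) \<ge> f xb + g \<bullet> u + g \<bullet> y + \<eta> * norm y"
proof -
  obtain e where e: "e > 0" "ball g e \<inter> affine hull (subdifferential f xb) \<subseteq> subdifferential f xb"
    using g_rel_interior unfolding mem_rel_interior_ball by blast
  have aff: "affine hull (subdifferential f xb) = (+) g ` span (V ` J)"
    using affine_hull_span_gen[OF hull_inc[OF g_subgradient]] V_space_eq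
    unfolding V_space_def by simp
  show ?thesis
  proof (intro exI[of _ "e / 2"] conjI ballI)
    show "e / 2 > 0" using e by simp
    fix u y assume u: "u \<in> null_space_transpose J V" and y: "y \<in> span (V ` J)"
    \<comment> \<open>Half the radius keeps \<open>s\<close> inside the open ball. For
      \<open>y = 0\<close>, division by zero gives \<open>t = 0\<close> and
      \<open>s = g\<close>.\<close>
    define t where "t = e / 2 / norm y"
    define s where "s = g + t *\<^sub>R y"
    have "s \<in> ball g e" using e(1) by (simp add: s_def t_def dist_norm)
    moreover have "s \<in> affine hull (subdifferential f xb)"
      unfolding aff s_def using y by (intro imageI span_scale)
    ultimately have "s \<in> subdifferential f xb" using e(2) by blast
    then have "\<forall>z. f z \<ge> f xb + s \<bullet> (z - xb)" by (simp add: subdifferential_def)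
    from this[rule_format, of "xb + u + y"] have "f (xb + u + y) \<ge> f xb + s \<bullet> (u + y)"
      by (simp add: add.assoc)
    moreover have "y \<bullet> u = 0" using u y by (auto simp: null_space_transpose_eq orthogonal_def)
    moreover have "t * (y \<bullet> y) = e / 2 * norm y"
      by (simp add: t_def dot_square_norm power2_eq_square)
    ultimately show "f (xb + u + y) \<ge> f xb + g \<bullet> u + g \<bullet> y + e / 2 * norm y"
      by (simp add: s_def inner_add_left inner_add_right)
  qed
qed

text \<open>The minimum in the \<open>\<U>\<close>-Lagrangian is attained, so \<^const>\<open>Least\<close> is not a junk value.\<close>

lemma U_Lagrangian_bounds:
  assumes U: "orthonormal_basis_matrix k U (null_space_transpose J V)"
  shows "f xb + g \<bullet> mult_vec {..<k} U u \<le> U_Lagrangian f xb k U J V g u"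
    and "U_Lagrangian f xb k U J V g u \<le> f (xb + mult_vec {..<k} U u)"
proof -
  define w where "w = mult_vec {..<k} U u"
  have w: "w \<in> null_space_transpose J V"
    using U mult_vec_in_span[of "{..<k}" U u] by (simp add: orthonormal_basis_matrix_def w_def)
  define \<phi> where "\<phi> p = f (xb + w + p) - g \<bullet> p" for p
  obtain \<eta> where \<eta>: "\<eta> > 0" and "\<forall>u\<in>null_space_transpose J V. \<forall>y\<in>span (V ` J).
     f (xb + u + y) \<ge> f xb + g \<bullet> u + g \<bullet> y + \<eta> * norm y"
    using f_growth_along_V by blast
  then have \<phi>_ge: "\<phi> p \<ge> f xb + g \<bullet> w + \<eta> * norm p" if "p \<in> span (V ` J)" for p
    using w that unfolding \<phi>_def by fastforce
  \<comment> \<open>Beyond radius \<open>R\<close> the growth bound already exceeds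
    \<open>\<phi> 0\<close>, so minimising over a compact ball in \<V> suffices.\<close>
  define R where "R = (\<phi> 0 - f xb - g \<bullet> w) / \<eta>"
  have R0: "R \<ge> 0" using \<phi>_ge[of 0] \<eta> by (simp add: R_def span_zero)
  have "\<exists>p\<in>span (V ` J) \<inter> cball 0 R. \<forall>q\<in>span (V ` J) \<inter> cball 0 R. \<phi> p \<le> \<phi> q"
  proof (rule continuous_attains_inf)
    show "compact (span (V ` J) \<inter> cball 0 R)" by (intro closed_Int_compact closed_span) auto
    show "span (V ` J) \<inter> cball 0 R \<noteq> {}" using R0 span_zero by fastforce
    show "continuous_on (span (V ` J) \<inter> cball 0 R) \<phi>" unfolding \<phi>_def
      by (intro continuous_intros continuous_on_compose2[OF f_continuous]) auto
  qed
  then obtain p where p: "p \<in> span (V ` J)" and min: "\<And>q. q \<in> span (V ` J) \<Longrightarrow> norm q \<le> R \<Longrightarrow> \<phi> p \<le> \<phi> q"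
    by auto
  have min': "\<phi> p \<le> \<phi> q" if q: "q \<in> span (V ` J)" for q
  proof (cases "norm q \<le> R")
    case False
    then have "\<eta> * R \<le> \<eta> * norm q" using \<eta> by simp
    then have "\<phi> 0 \<le> \<phi> q" using \<phi>_ge[OF q] \<eta> by (simp add: R_def)
    then show ?thesis using min[of 0] R0 by (simp add: span_zero)
  qed (use min q in auto)
  have "U_Lagrangian f xb k U J V g u = \<phi> p"
    unfolding U_Lagrangian_def
  proof (rule Least_equality)
    show "\<exists>v. \<phi> p = f (xb + mult_vec {..<k} U u + mult_vec J V v) - g \<bullet> mult_vec J V v"
      using p by (auto simp: span_image_eq_range_mult_vec[OF finite_J] \<phi>_def w_def)
    show "\<phi> p \<le> y" if "\<exists>v. y = f (xb + mult_vec {..<k} U u + mult_vec J V v) - g \<bullet> mult_vec J V v" for y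
      using that min'[OF mult_vec_in_span] by (auto simp: \<phi>_def w_def)
  qed
  moreover have "\<phi> p \<ge> f xb + g \<bullet> w"
    using \<phi>_ge[OF p] \<eta> by (smt (verit) mult_nonneg_nonneg norm_ge_zero)
  moreover have "\<phi> p \<le> f (xb + w)" using min'[of 0] by (simp add: span_zero \<phi>_def)
  ultimately show "f xb + g \<bullet> mult_vec {..<k} U u \<le> U_Lagrangian f xb k U J V g u"
    and "U_Lagrangian f xb k U J V g u \<le> f (xb + mult_vec {..<k} U u)"
    by (simp_all add: w_def)
qed

text \<open>The function is squeezed between an affine function and that function plus a quadratic
  error. The two bounds meet at \<open>u = 0\<close>, so the slope is that of the affine
  function.\<close>

lemma U_Lagrangian_gradient:
  assumes U: "orthonormal_basis_matrix k U (null_space_transpose J V)"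
  shows "has_gradient_at {..<k} (U_Lagrangian f xb k U J V g) (transpose_mult_vec U g) (\<lambda>_. 0)"
  unfolding has_gradient_at_def
proof (intro allI impI)
  fix e :: real assume e: "e > 0"
  obtain r where r: "r > 0" and R: "\<And>y. dist y xb < r \<Longrightarrow>
      \<exists>i\<in>A. f y \<le> f xb + G i \<bullet> (y - xb) + C * (norm (y - xb))\<^sup>2"
    using eventually_f_le unfolding eventually_nhds_metric by blast
  let ?L = "U_Lagrangian f xb k U J V g"
  let ?w = "mult_vec {..<k} U"
  have w: "?w u \<in> null_space_transpose J V" for u
    using U mult_vec_in_span[of "{..<k}" U u] by (simp add: orthonormal_basis_matrix_def)
  have "?w (\<lambda>_. 0) = 0" by (simp add: mult_vec_def)
  then have L0: "?L (\<lambda>_. 0) = f xb"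
    using U_Lagrangian_bounds[OF U, of "\<lambda>_. 0"] by simp
  have gw: "(\<Sum>j<k. transpose_mult_vec U g j * u j) = g \<bullet> ?w u" for u
    by (simp add: transpose_mult_vec_def mult_vec_def inner_sum_right inner_commute[of g] mult.commute)
  have nw: "L2_set u {..<k} = norm (?w u)" for u
    using U norm_mult_vec_orthonormal[of k U u] by (simp add: orthonormal_basis_matrix_def)
  show "\<exists>\<delta>>0. \<forall>u. L2_set (\<lambda>j. u j - 0) {..<k} < \<delta> \<longrightarrow>
      \<bar>?L u - ?L (\<lambda>_. 0) - (\<Sum>j<k. transpose_mult_vec U g j * (u j - 0))\<bar> \<le> e * L2_set (\<lambda>j. u j - 0) {..<k}"
  \<comment> \<open>\<open>r\<close> keeps the point where an active piece bounds \<open>f\<close>;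
    e/(C+1) turns the quadratic error into at most e times the norm, also when C = 0.\<close>
  proof (intro exI[of _ "min r (e / (C + 1))"] conjI allI impI)
    show "min r (e / (C + 1)) > 0" using r e C_nonneg by simp
    fix u assume "L2_set (\<lambda>j. u j - 0) {..<k} < min r (e / (C + 1))"
    then have small: "norm (?w u) < r" "norm (?w u) \<le> e / (C + 1)" by (simp_all add: nw)
    obtain i where i: "i \<in> A" "f (xb + ?w u) \<le> f xb + G i \<bullet> ?w u + C * (norm (?w u))\<^sup>2"
      using R[of "xb + ?w u"] small(1) by (auto simp: dist_norm)
    have "C * norm (?w u) \<le> e"
    proof -
      have "(C + 1) * norm (?w u) \<le> e" using small(2) C_nonneg by (simp add: pos_le_divide_eq mult.commute)
      then show ?thesis using norm_ge_zero[of "?w u"] unfolding distrib_right by linarith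
    qed
    then have "C * (norm (?w u))\<^sup>2 \<le> e * norm (?w u)"
      by (simp add: power2_eq_square mult.assoc[symmetric] mult_right_mono)
    then have "\<bar>?L u - f xb - g \<bullet> ?w u\<bar> \<le> e * norm (?w u)"
      using U_Lagrangian_bounds[OF U, of u] i(2) unfolding gradient_inner_U[OF i(1) w] by linarith
    then show "\<bar>?L u - ?L (\<lambda>_. 0) - (\<Sum>j<k. transpose_mult_vec U g j * (u j - 0))\<bar> \<le> e * L2_set (\<lambda>j. u j - 0) {..<k}"
      by (simp only: L0 diff_0_right gw nw)
  qed
qed

section \<open>Error bounds for the outputs of the subroutine\<close>

text \<open>Giving index \<open>I\<close> minus the sum of the other coefficients turns a linear
  relation among the columns into an affine relation among the active gradients.\<close>

lemma V_inverse_bound: "\<exists>B. inverse_bound J V B"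
proof (rule inverse_bound_exists[OF finite_J])
  fix c assume c: "mult_vec J V c = 0"
  define c' where "c' = c(I := - (\<Sum>j\<in>J. c j))"
  have cJ: "c' j = c j" if "j \<in> J" for j using that I_notin_J by (auto simp: c'_def)
  have cI: "c' I = - (\<Sum>j\<in>J. c j)" by (simp add: c'_def)
  have "(\<Sum>i\<in>A. c' i) = 0"
    by (simp add: sum_A cI cJ)
  moreover have "(\<Sum>i\<in>A. c' i *\<^sub>R G i) = 0"
    using c by (simp add: sum_A cI cJ mult_vec_def V_matrix_def
        scaleR_diff_right sum_subtractf scaleR_sum_left)
  ultimately have "\<forall>i\<in>A. c' i = 0" using active_independent unfolding affinely_independent_family_def by blast
  then show "\<forall>j\<in>J. c j = 0" using cJ A_eq by (metis insertI2)
qed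

text \<open>\<open>\<mu>\<close> is chosen before \<open>U\<close>, hence is uniform over the
  orthonormal bases of \<U>. For each small \<epsilon>, the free basis in the output is chosen close
  to the given \<open>U\<close>.\<close>

lemma first_order_output_error:
  "\<exists>\<mu>. \<forall>k U. orthonormal_basis_matrix k U (null_space_transpose J V) \<longrightarrow>
    (\<forall>\<^sub>F \<epsilon> in at_right 0. \<exists>g\<^sub>\<epsilon> V\<^sub>\<epsilon> U\<^sub>\<epsilon> d\<^sub>\<epsilon>.
      first_order_output f F m xb \<epsilon> g\<^sub>\<epsilon> V\<^sub>\<epsilon> k U\<^sub>\<epsilon> d\<^sub>\<epsilon> \<and>
      norm (g\<^sub>\<epsilon> - g) \<le> \<epsilon> * \<mu> \<and>
      L2_set (\<lambda>a. transpose_mult_vec U\<^sub>\<epsilon> g\<^sub>\<epsilon> a - transpose_mult_vec U g a) {..<k} \<le> \<epsilon> * \<mu> \<and>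
      L2_set (\<lambda>j. V_component J V\<^sub>\<epsilon> g\<^sub>\<epsilon> j - V_component J V g j) J \<le> \<epsilon> * \<mu> \<and>
      L2_set (\<lambda>a. d\<^sub>\<epsilon> a - transpose_mult_vec U g a) {..<k} \<le> \<epsilon> * \<mu>)"
proof -
  obtain B where B: "inverse_bound J V B" using V_inverse_bound by blast
  then have B0: "B \<ge> 0" by (simp add: inverse_bound_def)
  \<comment> \<open>The number of columns is fixed by the dimension, so the Gram--Schmidt constant
    \<open>E\<close> can be obtained before any basis is given.\<close>
  define k where "k = dim (null_space_transpose J V)"
  obtain E where E0: "E \<ge> 0" and E: "\<And>(U :: nat \<Rightarrow> real^'n) S \<eta>. subspace S \<Longrightarrow>
     \<forall>a<k. \<forall>b<k. U a \<bullet> U b = (if a = b then 1 else 0) \<Longrightarrow>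
     \<forall>a<k. \<exists>p\<in>S. norm (U a - p) \<le> \<eta> \<Longrightarrow> E * \<eta> < 1 \<Longrightarrow> \<eta> \<ge> 0 \<Longrightarrow>
     \<exists>W. (\<forall>a<k. W a \<in> S \<and> norm (W a - U a) \<le> E * \<eta>) \<and>
          (\<forall>a<k. \<forall>b<k. W a \<bullet> W b = (if a = b then 1 else 0))"
    using orthonormal_near_subspace[where ?'a = "real^'n" and k = k] by blast
  define D where "D = real CARD('n) * C"
  have D0: "D \<ge> 0" using C_nonneg by (simp add: D_def)
  define K where "K = 2 * B * (1 + 2 * B * norm (g - mult_vec J V (V_component J V g)) + (\<Sum>j\<in>J. \<bar>V_component J V g j\<bar>))"
  define H where "H = real k * (E * (2 * B) * norm g + 1)"
  have K0: "K \<ge> 0" unfolding K_def using B0 by (intro mult_nonneg_nonneg add_nonneg_nonneg sum_nonneg) auto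
  have H0: "H \<ge> 0" unfolding H_def using B0 E0 by (intro mult_nonneg_nonneg add_nonneg_nonneg) auto
  \<comment> \<open>The summands serve the bounds on \<open>g\<close>, on the \<U>-components and on
    the \<V>-components; 2D converts \<delta> into \<epsilon>.\<close>
  define \<mu> where "\<mu> = (1 + H + K) * (2 * D)"
  have small: "\<forall>\<^sub>F \<epsilon> in at_right 0. c * \<epsilon> < b" if "b > 0" for b c :: real
  proof -
    have "((\<lambda>t. c * t) \<longlongrightarrow> c * 0) (at_right 0)" by (intro tendsto_intros)
    then show ?thesis using that by (intro order_tendstoD(2)) auto
  qed
  have "\<forall>\<^sub>F \<epsilon> in at_right 0. \<forall>i\<in>{1..m}. norm (simplex_gradient \<epsilon> (F i) xb - G i) \<le> D * \<epsilon>"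
    unfolding D_def using simplex_gradient_error[OF F_expansion] by (intro eventually_ball_finite) auto
  \<comment> \<open>The bound 1/2 permits the perturbation of the columns, the bound 1 permits
    Gram--Schmidt with \<eta> = 2B\<delta>.\<close>
  then have ev: "\<forall>\<^sub>F \<epsilon> in at_right 0. \<epsilon> > 0 \<and> B * (2 * D * \<epsilon>) \<le> 1 / 2 \<and> E * (2 * B * (2 * D * \<epsilon>)) < 1 \<and>
      (\<forall>i\<in>A. norm (simplex_gradient \<epsilon> (F i) xb - G i) \<le> D * \<epsilon>)"
    using eventually_at_right_less[of "0::real"] small[of "1 / 2" "B * (2 * D)", simplified]
      small[of 1 "E * (2 * B * (2 * D))", simplified]
    by eventually_elim (auto simp: mult.assoc dest: activeD(1))
  show ?thesis
  proof (intro exI[of _ \<mu>] allI impI)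
    fix k' U
    assume U: "orthonormal_basis_matrix k' U (null_space_transpose J V)"
    have k': "k' = k" using orthonormal_basis_matrix_dim[OF U] by (simp add: k_def)
    have UU: "\<forall>a<k. \<forall>b<k. U a \<bullet> U b = (if a = b then 1 else 0)"
      using U by (simp add: orthonormal_basis_matrix_def k')
    have US: "U a \<in> null_space_transpose J V" if "a < k" for a
      using U that span_base[of "U a" "U ` {..<k}"] by (simp add: orthonormal_basis_matrix_def k')
    show "\<forall>\<^sub>F \<epsilon> in at_right 0. \<exists>g\<^sub>\<epsilon> V\<^sub>\<epsilon> U\<^sub>\<epsilon> d\<^sub>\<epsilon>.
      first_order_output f F m xb \<epsilon> g\<^sub>\<epsilon> V\<^sub>\<epsilon> k' U\<^sub>\<epsilon> d\<^sub>\<epsilon> \<and>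
      norm (g\<^sub>\<epsilon> - g) \<le> \<epsilon> * \<mu> \<and>
      L2_set (\<lambda>a. transpose_mult_vec U\<^sub>\<epsilon> g\<^sub>\<epsilon> a - transpose_mult_vec U g a) {..<k'} \<le> \<epsilon> * \<mu> \<and>
      L2_set (\<lambda>j. V_component J V\<^sub>\<epsilon> g\<^sub>\<epsilon> j - V_component J V g j) J \<le> \<epsilon> * \<mu> \<and>
      L2_set (\<lambda>a. d\<^sub>\<epsilon> a - transpose_mult_vec U g a) {..<k'} \<le> \<epsilon> * \<mu>"
      using ev
    proof eventually_elim
      case (elim \<epsilon>)
      \<comment> \<open>The factor 2 arises because a column of \<open>V\<close> is a difference of
        two gradients.\<close>
      define \<delta> where "\<delta> = 2 * D * \<epsilon>"
      have \<delta>0: "\<delta> \<ge> 0" and B\<delta>: "B * \<delta> \<le> 1 / 2" and E\<delta>: "E * (2 * B * \<delta>) < 1"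
        using elim D0 by (auto simp: \<delta>_def)
      have sg: "norm (simplex_gradient \<epsilon> (F i) xb - G i) \<le> D * \<epsilon>" if "i \<in> A" for i using elim that by blast
      define g' where "g' = (1 / real (card A)) *\<^sub>R (\<Sum>i\<in>A. simplex_gradient \<epsilon> (F i) xb)"
      define V' where "V' i = simplex_gradient \<epsilon> (F i) xb - simplex_gradient \<epsilon> (F I) xb" for i
      have V': "norm (V' j - V j) \<le> \<delta>" if "j \<in> J" for j
      proof -
        have j: "j \<in> A" using that A_eq by blast
        have "V' j - V j = (simplex_gradient \<epsilon> (F j) xb - G j) - (simplex_gradient \<epsilon> (F I) xb - G I)"
          by (simp add: V'_def V_matrix_def)
        then have "norm (V' j - V j) \<le> norm (simplex_gradient \<epsilon> (F j) xb - G j) + norm (simplex_gradient \<epsilon> (F I) xb - G I)"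
          by (simp only: norm_triangle_ineq4)
        then show ?thesis using sg[OF j] sg[OF I_in_A] by (simp add: \<delta>_def)
      qed
      have g': "norm (g' - g) \<le> \<delta>"
      proof -
        have "g' - g = (1 / real (card A)) *\<^sub>R (\<Sum>i\<in>A. simplex_gradient \<epsilon> (F i) xb - G i)"
          by (simp add: g'_def g_def sum_subtractf scaleR_diff_right)
        then have "norm (g' - g) = norm (\<Sum>i\<in>A. simplex_gradient \<epsilon> (F i) xb - G i) / real (card A)" by simp
        also have "\<dots> \<le> (\<Sum>i\<in>A. D * \<epsilon>) / real (card A)"
          using sg by (intro divide_right_mono sum_norm_le) auto
        also have "\<dots> = D * \<epsilon>" using card_A_pos by simp
        also have "\<dots> \<le> \<delta>" using \<delta>0 by (simp add: \<delta>_def)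
        finally show ?thesis .
      qed
      have B': "inverse_bound J V' (2 * B)" by (rule inverse_bound_perturb[OF B V' B\<delta>])
      let ?S = "null_space_transpose J V'"
      have "\<exists>p\<in>?S. norm (U a - p) \<le> 2 * B * \<delta>" if "a < k" for a
        using UU that
        by (intro null_space_transpose_approx[OF finite_J B' V' \<delta>0 US[OF that]]) (auto simp: norm_eq_sqrt_inner)
      then obtain W where WS: "\<And>a. a < k \<Longrightarrow> W a \<in> ?S" and WU: "\<And>a. a < k \<Longrightarrow> norm (W a - U a) \<le> E * (2 * B * \<delta>)"
        and WW: "\<forall>a<k. \<forall>b<k. W a \<bullet> W b = (if a = b then 1 else 0)"
        using E[OF subspace_null_space_transpose UU, of J V' "2 * B * \<delta>"] E\<delta> B0 \<delta>0 by auto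
      have "dim ?S = k"
        using dim_null_space_transpose[OF finite_J B'] dim_null_space_transpose[OF finite_J B] by (simp add: k_def)
      then have W: "orthonormal_basis_matrix k W ?S"
        using WW WS by (intro orthonormal_basis_matrixI subspace_null_space_transpose)
      have comp: "\<bar>W a \<bullet> g' - U a \<bullet> g\<bar> \<le> (E * (2 * B) * norm g + 1) * \<delta>" if a: "a < k" for a
      proof -
        have "norm (W a) = 1" using WW a by (simp add: norm_eq_sqrt_inner)
        then have "\<bar>W a \<bullet> (g' - g)\<bar> \<le> \<delta>"
          using Cauchy_Schwarz_ineq2[of "W a" "g' - g"] g' by simp
        moreover have "\<bar>(W a - U a) \<bullet> g\<bar> \<le> E * (2 * B * \<delta>) * norm g"
          by (rule order_trans[OF Cauchy_Schwarz_ineq2 mult_right_mono[OF WU[OF a]]]) simp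
        \<comment> \<open>The error splits into that of the subgradient, seen by a unit vector, and
          that of the basis, seen by the fixed vector \<open>g\<close>.\<close>
        moreover have "W a \<bullet> g' - U a \<bullet> g = W a \<bullet> (g' - g) + (W a - U a) \<bullet> g"
          by (simp add: inner_diff_left inner_diff_right)
        ultimately show ?thesis by (simp add: algebra_simps)
      qed
      have le_\<mu>: "t \<le> \<epsilon> * \<mu>" if "t \<le> c * \<delta>" "c \<le> 1 + H + K" for t c
      proof -
        have "t \<le> (1 + H + K) * \<delta>" using that \<delta>0 by (meson mult_right_mono order_trans)
        then show ?thesis by (simp add: \<mu>_def \<delta>_def mult_ac)
      qed
      have "L2_set (\<lambda>a. transpose_mult_vec W g' a - transpose_mult_vec U g a) {..<k}
          \<le> (\<Sum>a<k. \<bar>W a \<bullet> g' - U a \<bullet> g\<bar>)"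
        unfolding transpose_mult_vec_def by (rule L2_set_le_sum_abs)
      also have "\<dots> \<le> (\<Sum>a<k. (E * (2 * B) * norm g + 1) * \<delta>)" using comp by (intro sum_mono) auto
      also have "\<dots> = H * \<delta>" by (simp add: H_def)
      finally have 1: "L2_set (\<lambda>a. transpose_mult_vec W g' a - transpose_mult_vec U g a) {..<k} \<le> \<epsilon> * \<mu>"
        using K0 by (intro le_\<mu>[of _ H]) auto
      have 2: "L2_set (\<lambda>j. V_component J V' g' j - V_component J V g j) J \<le> \<epsilon> * \<mu>"
        using V_component_perturb[OF finite_J B V' B\<delta> g'] H0 by (intro le_\<mu>[of _ K]) (auto simp: K_def)
      have 3: "norm (g' - g) \<le> \<epsilon> * \<mu>" using g' H0 K0 by (intro le_\<mu>[of _ 1]) auto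
      \<comment> \<open>The approximate \<U>-gradient is by definition the \<U>-component of
        \<open>g'\<close>, so estimate \<open>1\<close> also gives the last bound.\<close>
      have "first_order_output f F m xb \<epsilon> g' V' k' W (transpose_mult_vec W g')"
        using W unfolding first_order_output_def k' by (simp add: g'_def V'_def[abs_def])
      with 1 2 3 show ?case unfolding k' by blast
    qed
  qed
qed

end

text \<open>The basis \<open>U\<close> of the exact \<U>-space is arbitrary, and
  \<open>\<mu>\<close> and \<open>g\<close> do not depend on it. The witness for the \<U>-gradient
  \<open>d\<close> is \<open>transpose_mult_vec U g\<close>.\<close>

theorem theorem3p6:
  fixes f :: "real^'n::finite \<Rightarrow> real"
    and F :: "nat \<Rightarrow> real^'n \<Rightarrow> real"
    and m :: nat
    and xb :: "real^'n"
  assumes "m \<ge> 1"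
    and "convex_on UNIV f"
    and "\<And>x. f x = Max ((\<lambda>i. F i x) ` {1..m})"
    and "\<And>i. i \<in> {1..m} \<Longrightarrow> C2plus (F i)"
    and "\<And>x. affinely_independent_family (active f F m x) (\<lambda>i. grad (F i) x)"
  defines "J \<equiv> V_indices f F m xb"
    and "V \<equiv> V_matrix f F m xb"
  shows "\<exists>\<mu>::real. \<exists>g \<in> rel_interior (subdifferential f xb).
    \<forall>k U. orthonormal_basis_matrix k U (U_space f xb g) \<longrightarrow>
      (\<exists>d. has_gradient_at {..<k} (U_Lagrangian f xb k U J V g) d (\<lambda>_. 0) \<and>
        (\<forall>\<^sub>F \<epsilon> in at_right 0. \<exists>g\<^sub>\<epsilon> V\<^sub>\<epsilon> U\<^sub>\<epsilon> d\<^sub>\<epsilon>.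
          first_order_output f F m xb \<epsilon> g\<^sub>\<epsilon> V\<^sub>\<epsilon> k U\<^sub>\<epsilon> d\<^sub>\<epsilon> \<and>
          norm (g\<^sub>\<epsilon> - g) \<le> \<epsilon> * \<mu> \<and>
          L2_set (\<lambda>a. transpose_mult_vec U\<^sub>\<epsilon> g\<^sub>\<epsilon> a - transpose_mult_vec U g a) {..<k} \<le> \<epsilon> * \<mu> \<and>
          L2_set (\<lambda>j. V_component J V\<^sub>\<epsilon> g\<^sub>\<epsilon> j - V_component J V g j) J \<le> \<epsilon> * \<mu> \<and>
          L2_set (\<lambda>a. d\<^sub>\<epsilon> a - d a) {..<k} \<le> \<epsilon> * \<mu>))"
proof -
  have "\<forall>i\<in>{1..m}. \<exists>C\<ge>0. \<forall>\<^sub>F y in nhds xb.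
      \<bar>F i y - F i xb - grad (F i) xb \<bullet> (y - xb)\<bar> \<le> C * (norm (y - xb))\<^sup>2"
    using assms(4) unfolding C2plus_def by (intro ballI first_order_expansion) blast+
  from bchoice[OF this] obtain C where C0: "\<And>i. i \<in> {1..m} \<Longrightarrow> C i \<ge> 0"
    and C: "\<And>i. i \<in> {1..m} \<Longrightarrow> \<forall>\<^sub>F y in nhds xb.
      \<bar>F i y - F i xb - grad (F i) xb \<bullet> (y - xb)\<bar> \<le> C i * (norm (y - xb))\<^sup>2"
    by blast
  \<comment> \<open>The sum of the nonnegative constants of the pieces dominates each of them and
    serves as the common constant.\<close>
  interpret max_function_point f F m xb "sum C {1..m}"
  proof
    fix i assume i: "i \<in> {1..m}"
    show "continuous_on UNIV (F i)"
      using assms(4)[OF i] local_lipschitz_continuous_on[of "{0}" UNIV "\<lambda>_. F i" "0::real"]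
      by (simp add: C2plus_def locally_lipschitz_def)
    have "C i \<le> sum C {1..m}" using C0 i by (intro member_le_sum) auto
    with C[OF i] show "\<forall>\<^sub>F y in nhds xb.
        \<bar>F i y - F i xb - grad (F i) xb \<bullet> (y - xb)\<bar> \<le> sum C {1..m} * (norm (y - xb))\<^sup>2"
      by (elim eventually_mono) (meson mult_right_mono order_trans zero_le_power2)
  next
    show "sum C {1..m} \<ge> 0" using C0 by (rule sum_nonneg)
  qed (fact assms(1-3,5))+
  obtain \<mu> where \<mu>: "\<forall>k U. orthonormal_basis_matrix k U (null_space_transpose J V) \<longrightarrow>
    (\<forall>\<^sub>F \<epsilon> in at_right 0. \<exists>g\<^sub>\<epsilon> V\<^sub>\<epsilon> U\<^sub>\<epsilon> d\<^sub>\<epsilon>.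
      first_order_output f F m xb \<epsilon> g\<^sub>\<epsilon> V\<^sub>\<epsilon> k U\<^sub>\<epsilon> d\<^sub>\<epsilon> \<and>
      norm (g\<^sub>\<epsilon> - g) \<le> \<epsilon> * \<mu> \<and>
      L2_set (\<lambda>a. transpose_mult_vec U\<^sub>\<epsilon> g\<^sub>\<epsilon> a - transpose_mult_vec U g a) {..<k} \<le> \<epsilon> * \<mu> \<and>
      L2_set (\<lambda>j. V_component J V\<^sub>\<epsilon> g\<^sub>\<epsilon> j - V_component J V g j) J \<le> \<epsilon> * \<mu> \<and>
      L2_set (\<lambda>a. d\<^sub>\<epsilon> a - transpose_mult_vec U g a) {..<k} \<le> \<epsilon> * \<mu>)"
    using first_order_output_error unfolding J_def V_def by (rule exE)
  show ?thesis
  proof (intro exI[of _ \<mu>] bexI[of _ g] allI impI)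
    show "g \<in> rel_interior (subdifferential f xb)" by (rule g_rel_interior)
    fix k U assume U: "orthonormal_basis_matrix k U (U_space f xb g)"
    show "\<exists>d. has_gradient_at {..<k} (U_Lagrangian f xb k U J V g) d (\<lambda>_. 0) \<and>
        (\<forall>\<^sub>F \<epsilon> in at_right 0. \<exists>g\<^sub>\<epsilon> V\<^sub>\<epsilon> U\<^sub>\<epsilon> d\<^sub>\<epsilon>.
          first_order_output f F m xb \<epsilon> g\<^sub>\<epsilon> V\<^sub>\<epsilon> k U\<^sub>\<epsilon> d\<^sub>\<epsilon> \<and>
          norm (g\<^sub>\<epsilon> - g) \<le> \<epsilon> * \<mu> \<and>
          L2_set (\<lambda>a. transpose_mult_vec U\<^sub>\<epsilon> g\<^sub>\<epsilon> a - transpose_mult_vec U g a) {..<k} \<le> \<epsilon> * \<mu> \<and>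
          L2_set (\<lambda>j. V_component J V\<^sub>\<epsilon> g\<^sub>\<epsilon> j - V_component J V g j) J \<le> \<epsilon> * \<mu> \<and>
          L2_set (\<lambda>a. d\<^sub>\<epsilon> a - d a) {..<k} \<le> \<epsilon> * \<mu>)"
    proof (intro exI[of _ "transpose_mult_vec U g"] conjI)
      show "has_gradient_at {..<k} (U_Lagrangian f xb k U J V g) (transpose_mult_vec U g) (\<lambda>_. 0)"
        unfolding J_def V_def using U U_space_eq by (intro U_Lagrangian_gradient) simp
    qed (use \<mu> U in \<open>unfold U_space_eq J_def[symmetric] V_def[symmetric], blast\<close>)
  qed
qed

end
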